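(* Let $n\geqslant1$, $k\geqslant0$, and for $r>0$ let $B_0(r)=\{(q_0,\dots,q_{n-1})\in\mathbb{H}^n:\sqrt{|q_0|^2+|q_1|^2+\cdots+|q_{n-1}|^2}<r\}$. For all sufficiently small $\varepsilon>0$ (i.e. there is $\varepsilon_0\in(0,1)$ depending only on $n$ and $k$ such that for all $0<\varepsilon<\varepsilon_0$) the following holds: if $h\in\mathcal{R}^{(k)}(B_0(\varepsilon))$ and $h|_{\{q_0=0\}}=0$, then there exist $f,g\in\mathcal{R}^{(k+1)}(B_0(\varepsilon^2))$ satisfying $$L_0^{(k+1)}f+L_1^{(k+1)}g=h\qquad\text{on } B_0(\varepsilon^2).$$
   Context: Identify $\mathbb{H}^n$ with $\mathbb{R}^{4n}$ via $q_t=x_{4t}+\mathbf{i}x_{4t+1}+\mathbf{j}x_{4t+2}+\mathbf{k}x_{4t+3}$, $t=0,\dots,n-1$. With $\partial_m=\partial/\partial x_m$ and $i\in\mathbb{C}$ the imaginary unit, put $\nabla_{2t}^{0'}=-\partial_{4t+2}-i\partial_{4t+3}$, $\nabla_{2t}^{1'}=-\partial_{4t}-i\partial_{4t+1}$, $\nabla_{2t+1}^{0'}=\partial_{4t}-i\partial_{4t+1}$, $\nabla_{2t+1}^{1'}=-\partial_{4t+2}+i\partial_{4t+3}$. Fix a basis $\omega^0,\dots,\omega^{2n-1}$ of $\mathbb{C}^{2n}$. For $A'\in\{0',1'\}$ and a $\Lambda^p\mathbb{C}^{2n}$-valued function $f=\sum_I f_I\,\omega^I$ put $d^{A'}f=\sum_{A=0}^{2n-1}\sum_I\nabla_A^{A'}f_I\;\omega^A\wedge\omega^I$.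 Elements of the symmetric power $\odot^k\mathbb{C}^2$ are written $(f_{A_0'\cdots A_{k-1}'})$ with indices in $\{0',1'\}$ and components symmetric in the indices; $\odot^0\mathbb{C}^2=\mathbb{C}$. For $k\geqslant1$, a $C^1$ function $f:U\to\odot^k\mathbb{C}^2$ on an open set $U\subset\mathbb{R}^{4n}$ is $k$-regular if $d^{0'}f_{0'A_1'\cdots A_{k-1}'}+d^{1'}f_{1'A_1'\cdots A_{k-1}'}=0$ on $U$ for all $A_1',\dots,A_{k-1}'$. A ($C^2$) function $f:U\to\mathbb{C}$ is $0$-regular if $d^{0'}d^{1'}f=0$ on $U$. $\mathcal{R}^{(k)}(U)$ is the space of $k$-regular functions on $U$. Put $z_{2t}^{0'}=x_{4t+2}+ix_{4t+3}$, $z_{2t}^{1'}=x_{4t}+ix_{4t+1}$, $z_{2t+1}^{0'}=-x_{4t}+ix_{4t+1}$, $z_{2t+1}^{1'}=x_{4t+2}-ix_{4t+3}$. For $k\geqslant1$ and $A=0,\dots,2n-1$ the operator $L_A^{(k)}$ sends a $\odot^k\mathbb{C}^2$-valued function $f$ to the $\odot^{k-1}\mathbb{C}^2$-valued function $(L_A^{(k)}f)_{A_0'\cdots A_{k-2}'}=z_A^{0'}f_{0'A_0'\cdots A_{k-2}'}+z_A^{1'}f_{1'A_0'\cdots A_{k-2}'}$. *)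

theory Defs
  imports "HOL-Analysis.Analysis" "HOL-Library.Multiset" "HOL-Library.Numeral_Type"
begin

text \<open>
  Throughout, \<open>n = CARD('n)\<close>, an arbitrary positive number, and \<open>\<real>\<^sup>4\<^sup>n\<close> is the Euclidean
  space over the index type \<open>'n bit0 bit0\<close>, i.e. the integers modulo \<open>4n\<close>.  Its \<open>4n\<close> elements are
  \<open>of_nat m\<close> for \<open>m < 4n\<close>, so that the coordinate \<open>x\<^sub>m\<close> is \<open>x $ of_nat m\<close>.
\<close>

type_synonym 'n hvec = "(real, 'n bit0 bit0) vec"

definition crd :: "nat \<Rightarrow> ('n::finite) hvec \<Rightarrow> real" where
  "crd m x = x $ of_nat m"

text \<open>The quaternion \<open>q\<^sub>t\<close>, as the vector of its four real components.\<close>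

definition quat :: "nat \<Rightarrow> ('n::finite) hvec \<Rightarrow> real ^ 4" where
  "quat t x = vector [crd (4*t) x, crd (4*t+1) x, crd (4*t+2) x, crd (4*t+3) x]"

definition B0 :: "real \<Rightarrow> ('n::finite) hvec set" where
  "B0 r = {x. sqrt (\<Sum>t<CARD('n). (norm (quat t x))\<^sup>2) < r}"

definition pd :: "nat \<Rightarrow> (('n::finite) hvec \<Rightarrow> complex) \<Rightarrow> 'n hvec \<Rightarrow> complex" where
  "pd m \<phi> x = vector_derivative (\<lambda>s. \<phi> (x + s *\<^sub>R axis (of_nat m) 1)) (at 0)"

text \<open>\<open>C_on j U \<phi>\<close>: the function \<open>\<phi>\<close> is of class \<open>C\<^sup>j\<close> on the open set \<open>U\<close>.\<close>

fun C_on :: "nat \<Rightarrow> ('n::finite) hvec set \<Rightarrow> ('n hvec \<Rightarrow> complex) \<Rightarrow> bool" where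
  "C_on 0 U \<phi> \<longleftrightarrow> continuous_on U \<phi>"
| "C_on (Suc j) U \<phi> \<longleftrightarrow>
     (\<forall>x\<in>U. \<phi> differentiable (at x)) \<and> (\<forall>m<4 * CARD('n). C_on j U (pd m \<phi>))"

text \<open>The primed indices \<open>0'\<close> and \<open>1'\<close>.\<close>

datatype pidx = P0 | P1

definition nabla :: "nat \<Rightarrow> pidx \<Rightarrow> (('n::finite) hvec \<Rightarrow> complex) \<Rightarrow> 'n hvec \<Rightarrow> complex" where
  "nabla A a \<phi> x = (let t = A div 2 in
     if even A then
       (case a of
          P0 \<Rightarrow> - pd (4*t+2) \<phi> x - \<i> * pd (4*t+3) \<phi> x
        | P1 \<Rightarrow> - pd (4*t) \<phi> x - \<i> * pd (4*t+1) \<phi> x)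
     else
       (case a of
          P0 \<Rightarrow> pd (4*t) \<phi> x - \<i> * pd (4*t+1) \<phi> x
        | P1 \<Rightarrow> - pd (4*t+2) \<phi> x + \<i> * pd (4*t+3) \<phi> x))"

definition zc :: "nat \<Rightarrow> pidx \<Rightarrow> ('n::finite) hvec \<Rightarrow> complex" where
  "zc A a x = (let t = A div 2 in
     if even A then
       (case a of
          P0 \<Rightarrow> complex_of_real (crd (4*t+2) x) + \<i> * complex_of_real (crd (4*t+3) x)
        | P1 \<Rightarrow> complex_of_real (crd (4*t) x) + \<i> * complex_of_real (crd (4*t+1) x))
     else
       (case a of
          P0 \<Rightarrow> - complex_of_real (crd (4*t) x) + \<i> * complex_of_real (crd (4*t+1) x)
        | P1 \<Rightarrow> complex_of_real (crd (4*t+2) x) - \<i> * complex_of_real (crd (4*t+3) x)))"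

text \<open>
  An element of the exterior algebra of \<open>\<complex>\<^sup>2\<^sup>n\<close> is given by its coefficients with respect to the
  basis \<open>\<omega>\<^sup>I\<close>, \<open>I \<subseteq> {..<2n}\<close>, where \<open>\<omega>\<^sup>I\<close> is the wedge product of the \<open>\<omega>\<^sup>i\<close>, \<open>i \<in> I\<close>, in increasing order.
  \<open>wedge A I J\<close> is the coefficient at \<open>\<omega>\<^sup>J\<close> of \<open>\<omega>\<^sup>A \<and> \<omega>\<^sup>I\<close>; the sign
  comes from moving \<open>\<omega>\<^sup>A\<close> past the smaller indices in \<open>I\<close>.
\<close>

definition wedge :: "nat \<Rightarrow> nat set \<Rightarrow> nat set \<Rightarrow> complex" where
  "wedge A I J = (if A \<notin> I \<and> J = insert A I then (-1) ^ card {B\<in>I. B < A} else 0)"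

definition dform :: "pidx \<Rightarrow> (('n::finite) hvec \<Rightarrow> nat set \<Rightarrow> complex) \<Rightarrow> 'n hvec \<Rightarrow> nat set \<Rightarrow> complex" where
  "dform a F x J =
     (\<Sum>A<2 * CARD('n). \<Sum>I\<in>Pow {..<2 * CARD('n)}. nabla A a (\<lambda>y. F y I) x * wedge A I J)"

text \<open>A scalar function as a function with values in \<open>\<Lambda>\<^sup>0\<complex>\<^sup>2\<^sup>n\<close>.\<close>

definition form0 :: "(('n::finite) hvec \<Rightarrow> complex) \<Rightarrow> 'n hvec \<Rightarrow> nat set \<Rightarrow> complex" where
  "form0 \<phi> x I = (if I = {} then \<phi> x else 0)"

text \<open>
  The symmetric power \<open>\<odot>\<^sup>k\<complex>\<^sup>2\<close>: families of components indexed by the lists of \<open>k\<close> primed indices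
  and symmetric in them, extended by zero to lists of any other length.  For \<open>k = 0\<close> the only
  component is the one at the empty list.
\<close>

definition sympow :: "nat \<Rightarrow> (pidx list \<Rightarrow> complex) set" where
  "sympow k = {v. (\<forall>As Bs. length As = k \<and> mset As = mset Bs \<longrightarrow> v As = v Bs) \<and>
                  (\<forall>As. length As \<noteq> k \<longrightarrow> v As = 0)}"

text \<open>
  \<open>regular k U\<close> is the space of \<open>k\<close>-regular functions on the open set \<open>U\<close>; the values of its
  elements outside \<open>U\<close> are irrelevant.
\<close>

fun regular :: "nat \<Rightarrow> ('n::finite) hvec set \<Rightarrow> ('n hvec \<Rightarrow> pidx list \<Rightarrow> complex) set" where
  "regular 0 U = {f. (\<forall>x\<in>U. f x \<in> sympow 0) \<and> C_on 2 U (\<lambda>x. f x []) \<and>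
     (\<forall>x\<in>U. \<forall>J. dform P0 (dform P1 (form0 (\<lambda>y. f y []))) x J = 0)}"
| "regular (Suc k) U = {f. (\<forall>x\<in>U. f x \<in> sympow (Suc k)) \<and>
     (\<forall>As. length As = Suc k \<longrightarrow> C_on 1 U (\<lambda>x. f x As)) \<and>
     (\<forall>As. length As = k \<longrightarrow> (\<forall>x\<in>U. \<forall>J.
        dform P0 (form0 (\<lambda>y. f y (P0 # As))) x J + dform P1 (form0 (\<lambda>y. f y (P1 # As))) x J = 0))}"

text \<open>
  The operators \<open>L\<^sub>A\<^sup>(\<^sup>k\<^sup>)\<close> for all \<open>k \<ge> 1\<close> at once: if \<open>f\<close> has values in \<open>sympow k\<close>, then
  \<open>Lop A f\<close> has values in \<open>sympow (k - 1)\<close>.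
\<close>

definition Lop :: "nat \<Rightarrow> (('n::finite) hvec \<Rightarrow> pidx list \<Rightarrow> complex) \<Rightarrow> 'n hvec \<Rightarrow> pidx list \<Rightarrow> complex" where
  "Lop A f x As = zc A P0 x * f x (P0 # As) + zc A P1 x * f x (P1 # As)"

lemma Lop_sympow:
  assumes "f x \<in> sympow (Suc k)"
  shows "Lop A f x \<in> sympow k"
  using assms unfolding sympow_def Lop_def
  by (auto simp del: mset.simps simp: mset.simps(2) intro!: arg_cong2[where f = "(+)"] arg_cong2[where f = "(*)"])

lemma of_nat_bit0_bij:
  "bij_betw (of_nat :: nat \<Rightarrow> ('n::finite) bit0 bit0) {..<4 * CARD('n)} UNIV"
proof -
  have surj: "(of_nat :: nat \<Rightarrow> 'n bit0 bit0) ` {..<4 * CARD('n)} = UNIV"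
  proof (intro equalityI subset_UNIV subsetI)
    fix y :: "'n bit0 bit0"
    obtain z where z: "y = of_int z" "0 \<le> z" "z < int CARD('n bit0 bit0)"
      by (cases y rule: bit0_cases) auto
    then have "y = of_nat (nat z)" "nat z < 4 * CARD('n)" by auto
    then show "y \<in> of_nat ` {..<4 * CARD('n)}" by blast
  qed
  moreover have "card ((of_nat :: nat \<Rightarrow> 'n bit0 bit0) ` {..<4 * CARD('n)}) = card {..<4 * CARD('n)}"
    unfolding surj by simp
  ultimately show ?thesis
    by (simp add: bij_betw_def eq_card_imp_inj_on)
qed

lemma B0_eq_ball: "B0 r = ball (0 :: ('n::finite) hvec) r"
proof -
  have "(\<Sum>t<CARD('n). (norm (quat t x))\<^sup>2) = (norm x)\<^sup>2" for x :: "'n hvec"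
  proof -
    have "(\<Sum>t<CARD('n). (norm (quat t x))\<^sup>2)
        = (\<Sum>t<CARD('n). (crd (4*t) x)\<^sup>2 + (crd (4*t+1) x)\<^sup>2 + (crd (4*t+2) x)\<^sup>2 + (crd (4*t+3) x)\<^sup>2)"
      unfolding quat_def norm_vec_def L2_set_def
      by (simp add: sum_4 sum_nonneg vector_def)
    also have "\<dots> = (\<Sum>m<4 * CARD('n). (crd m x)\<^sup>2)"
    proof -
      have "(\<Sum>t<N. (crd (4*t) x)\<^sup>2 + (crd (4*t+1) x)\<^sup>2 + (crd (4*t+2) x)\<^sup>2 + (crd (4*t+3) x)\<^sup>2)
          = (\<Sum>m<4 * N. (crd m x)\<^sup>2)" for N
        by (induction N) (simp_all add: eval_nat_numeral algebra_simps)
      then show ?thesis .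
    qed
    also have "\<dots> = (\<Sum>i\<in>UNIV. (x $ i)\<^sup>2)"
      unfolding crd_def by (rule sum.reindex_bij_betw[OF of_nat_bit0_bij])
    also have "\<dots> = (norm x)\<^sup>2"
      by (simp add: norm_vec_def L2_set_def sum_nonneg)
    finally show ?thesis .
  qed
  then show ?thesis by (auto simp: B0_def)
qed

end

theory Submission
  imports Defs
begin

text \<open>
  Up to constants, \<open>nabla\<close> with flipped indices is differentiation with respect to the complex
  coordinates \<open>zc A a\<close>.  Applying \<open>\<partial>/\<partial>z\<^sub>A\<^sup>a\<close> to a \<open>k\<close>-regular function \<open>h\<close> and using \<open>a\<close> as an additional
  index gives a \<open>(k + 1)\<close>-regular function \<open>D\<^sub>A h\<close>, and \<open>L\<^sub>0 D\<^sub>0 h + L\<^sub>1 D\<^sub>1 h\<close> is the Euler operator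
  in the variable \<open>q\<^sub>0\<close> applied to \<open>h\<close>.  Hence \<open>f = \<integral>\<^sub>0\<^sup>1 (D\<^sub>0 h) (t q\<^sub>0, q') dt\<close> and the analogous \<open>g\<close>
  satisfy \<open>L\<^sub>0 f + L\<^sub>1 g = h (q\<^sub>0, q') - h (0, q')\<close>.  They are regular, since every single regularity
  equation involves derivatives in the direction of one quaternion only and therefore survives the
  rescaling of \<open>q\<^sub>0\<close>; this works on the whole ball, without shrinking the radius.

  The construction requires \<open>h\<close> to be of class \<open>C\<^sup>2\<close>.  For \<open>k \<ge> 1\<close> this follows from a mean value
  property: if \<open>\<phi>\<close> is a radial weight, then \<open>\<integral> \<phi>(y) y\<^sub>j \<partial>\<^sub>i h(x + s y) dy\<close> is symmetric in \<open>i\<close> and \<open>j\<close>,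
  and the regularity equations then force the trace \<open>d/ds \<integral> \<phi>(y) h(x + s y) dy\<close> to vanish.
\<close>

subsection \<open>Continuously differentiable functions\<close>

text \<open>The derivative is kept as a bounded linear operator, so that the continuity asked for in
  \<open>c1_on\<close> is continuity in the operator norm. The value is meaningful only where
  \<open>f\<close> is differentiable.\<close>

definition frd :: "('a::real_normed_vector \<Rightarrow> 'b::real_normed_vector) \<Rightarrow> 'a \<Rightarrow> 'a \<Rightarrow>\<^sub>L 'b" where
  "frd f x = Blinfun (frechet_derivative f (at x))"

definition c1_on :: "'a::real_normed_vector set \<Rightarrow> ('a \<Rightarrow> 'b::real_normed_vector) \<Rightarrow> bool" where
  "c1_on U f \<longleftrightarrow> (\<forall>x\<in>U. f differentiable (at x)) \<and> continuous_on U (frd f)"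

lemma frd_eq:
  assumes "(f has_derivative blinfun_apply D) (at x)"
  shows "frd f x = D"
  using frechet_derivative_at[OF assms, symmetric] by (simp add: frd_def blinfun_apply_inverse)

lemma frd_works:
  assumes "f differentiable (at x)"
  shows "(f has_derivative frd f x) (at x)"
  using assms unfolding frd_def frechet_derivative_works
  by (simp add: bounded_linear_Blinfun_apply has_derivative_bounded_linear)

lemma c1_onI:
  assumes "\<And>x. x \<in> U \<Longrightarrow> (f has_derivative blinfun_apply (f' x)) (at x)"
    and "continuous_on U f'"
  shows "c1_on U f"
  unfolding c1_on_def
proof
  show "\<forall>x\<in>U. f differentiable (at x)"
    using assms(1) by (auto simp: differentiable_def)
  show "continuous_on U (frd f)"
    using assms(2) by (rule continuous_on_cong[THEN iffD1, rotated -1]) (simp_all add: frd_eq[OF assms(1)])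
qed

lemma c1_on_has_derivative: "c1_on U f \<Longrightarrow> x \<in> U \<Longrightarrow> (f has_derivative frd f x) (at x)"
  by (simp add: c1_on_def frd_works)

lemma c1_on_continuous_frd: "c1_on U f \<Longrightarrow> continuous_on U (frd f)"
  by (simp add: c1_on_def)

lemma c1_on_continuous: "c1_on U f \<Longrightarrow> continuous_on U f"
  by (meson c1_on_has_derivative continuous_at_imp_continuous_on has_derivative_continuous)

lemma c1_on_subset: "c1_on U f \<Longrightarrow> V \<subseteq> U \<Longrightarrow> c1_on V f"
  by (auto simp: c1_on_def intro: continuous_on_subset)

lemma c1_on_local:
  assumes "\<And>x. x \<in> U \<Longrightarrow> \<exists>V. open V \<and> x \<in> V \<and> c1_on V f"
  shows "c1_on U f"
  unfolding c1_on_def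
proof
  show "\<forall>x\<in>U. f differentiable (at x)"
    using assms by (meson c1_on_def)
  show "continuous_on U (frd f)"
    using assms by (metis c1_on_def continuous_at_imp_continuous_on continuous_on_eq_continuous_at)
qed

lemma c1_on_cong:
  assumes "open U" and eq: "\<And>x. x \<in> U \<Longrightarrow> f x = g x" and "c1_on U f"
  shows "c1_on U g"
proof (rule c1_onI)
  show "(g has_derivative blinfun_apply (frd f x)) (at x)" if "x \<in> U" for x
    by (rule has_derivative_transform_within_open[OF c1_on_has_derivative[OF assms(3) that] assms(1) that])
       (rule eq)
qed (rule c1_on_continuous_frd[OF assms(3)])

lemma c1_on_bounded_linear:
  assumes "c1_on U f" and "bounded_linear L"
  shows "c1_on U (\<lambda>x. L (f x))"
proof -
  have L: "blinfun_apply (Blinfun L) = L"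
    by (simp add: assms(2) bounded_linear_Blinfun_apply)
  have d: "((\<lambda>x. L (f x)) has_derivative blinfun_apply (Blinfun L o\<^sub>L frd f x)) (at x)" if "x \<in> U" for x
    using bounded_linear.has_derivative[OF assms(2) c1_on_has_derivative[OF assms(1) that]]
    by (simp add: blinfun_compose.rep_eq L o_def)
  show "c1_on U (\<lambda>x. L (f x))"
    by (rule c1_onI, erule d) (intro continuous_intros c1_on_continuous_frd assms(1))
qed

lemma c1_on_add:
  assumes "c1_on U f" and "c1_on U g"
  shows "c1_on U (\<lambda>x. f x + g x)"
proof -
  have d: "((\<lambda>x. f x + g x) has_derivative blinfun_apply (frd f x + frd g x)) (at x)" if "x \<in> U" for x
    using has_derivative_add[OF assms[THEN c1_on_has_derivative, OF that]]
    by (simp add: plus_blinfun.rep_eq)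
  show "c1_on U (\<lambda>x. f x + g x)"
    by (rule c1_onI, erule d) (intro continuous_intros c1_on_continuous_frd assms)
qed

text \<open>Leibniz rule with an operator-valued derivative: joint continuity of \<open>f'\<close>
  makes its integral continuous in \<open>x\<close>, and evaluation at \<open>v\<close>, being
  bounded and linear, passes under the integral.\<close>

lemma c1_on_integral:
  fixes f :: "'a::banach \<Rightarrow> 'b::euclidean_space \<Rightarrow> 'c::banach"
  assumes "open U" "convex U"
    and d: "\<And>x t. x \<in> U \<Longrightarrow> t \<in> cbox a b \<Longrightarrow> ((\<lambda>x. f x t) has_derivative blinfun_apply (f' x t)) (at x)"
    and c: "\<And>x. x \<in> U \<Longrightarrow> continuous_on (cbox a b) (f x)"
    and c': "continuous_on (U \<times> cbox a b) (\<lambda>(x, t). f' x t)"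
  shows "c1_on U (\<lambda>x. integral (cbox a b) (f x))"
    and "x \<in> U \<Longrightarrow> frd (\<lambda>x. integral (cbox a b) (f x)) x v = integral (cbox a b) (\<lambda>t. f' x t v)"
proof -
  have D: "((\<lambda>x. integral (cbox a b) (f x)) has_derivative integral (cbox a b) (f' x)) (at x)"
    if "x \<in> U" for x
  proof -
    have "((\<lambda>x. integral (cbox a b) (f x)) has_derivative integral (cbox a b) (f' x)) (at x within U)"
      by (rule leibniz_rule)
         (use assms that in \<open>auto intro: integrable_continuous has_derivative_at_withinI\<close>)
    then show ?thesis
      using at_within_open[OF that \<open>open U\<close>] by simp
  qed
  show "c1_on U (\<lambda>x. integral (cbox a b) (f x))"
    by (rule c1_onI, erule D) (rule integral_continuous_on_param[OF c'])
  show "frd (\<lambda>x. integral (cbox a b) (f x)) x v = integral (cbox a b) (\<lambda>t. f' x t v)" if "x \<in> U"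
  proof -
    have "continuous_on (cbox a b) (f' x)"
      using continuous_on_compose2[OF c', of "cbox a b" "Pair x"] that
      by (simp add: image_subset_iff continuous_on_Pair)
    then show ?thesis
      using frd_eq[OF D[OF that]] by (simp add: blinfun_apply_integral integrable_continuous)
  qed
qed

text \<open>Differentiating \<open>f (x + t v) = f x + \<integral>\<^sub>0\<^sup>t \<partial>\<^sub>v f\<close> in the direction \<open>w\<close> and then in \<open>t\<close>.\<close>

lemma frd_commute:
  fixes f :: "'a::euclidean_space \<Rightarrow> 'b::banach"
  assumes "open U" and f: "c1_on U f"
    and v: "c1_on U (\<lambda>x. frd f x v)" and w: "c1_on U (\<lambda>x. frd f x w)" and x: "x \<in> U"
  shows "frd (\<lambda>x. frd f x v) x w = frd (\<lambda>x. frd f x w) x v"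
proof -
  obtain r where r: "r > 0" "ball x r \<subseteq> U"
    using \<open>open U\<close> x openE by blast
  define r' where "r' = r / 2"
  \<comment> \<open>For \<open>s \<le> d\<close> the shift \<open>s *\<^sub>R v\<close> has norm at
    most \<open>r'\<close>, so segments that start in the half-size ball stay in \<open>U\<close>.
    The summand 1 covers \<open>v = 0\<close>.\<close>
  define d where "d = r' / (norm v + 1)"
  have dpos: "d > 0" "r' > 0" using r by (auto simp: d_def r'_def add_nonneg_pos)
  have in_ball: "y + s *\<^sub>R v \<in> U" if "y \<in> ball x r'" "s \<in> {0..d}" for y s
  proof -
    have "norm (s *\<^sub>R v) \<le> d * norm v"
      using that by (auto intro!: mult_right_mono)
    also have "\<dots> \<le> r'"
    proof -
      have "r' * norm v \<le> r' * (norm v + 1)" using dpos by simp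
      then show ?thesis by (simp add: d_def divide_le_eq add_nonneg_pos)
    qed
    finally have "dist x (y + s *\<^sub>R v) < r"
      using that norm_triangle_ineq4[of "x - y" "s *\<^sub>R v"]
      by (auto simp: dist_norm r'_def algebra_simps)
    then show ?thesis using r by auto
  qed
  have derv: "((\<lambda>s. f (y + s *\<^sub>R v)) has_vector_derivative frd f (y + s *\<^sub>R v) v) (at s within S)"
    if "y + s *\<^sub>R v \<in> U" for y s S
  proof -
    have "((\<lambda>s. f (y + s *\<^sub>R v)) has_derivative (\<lambda>h. frd f (y + s *\<^sub>R v) (h *\<^sub>R v))) (at s within S)"
      by (rule has_derivative_compose[of "\<lambda>s. y + s *\<^sub>R v" _ _ _ f, OF _ c1_on_has_derivative[OF f that]])
         (auto intro!: derivative_eq_intros)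
    then show ?thesis by (simp add: has_vector_derivative_def blinfun.scaleR_right)
  qed
  have ftc: "f (y + t *\<^sub>R v) - f y = integral (cbox 0 t) (\<lambda>s. frd f (y + s *\<^sub>R v) v)"
    if "y \<in> ball x r'" "t \<in> {0..d}" for y t
  proof -
    have "((\<lambda>s. frd f (y + s *\<^sub>R v) v) has_integral f (y + t *\<^sub>R v) - f (y + 0 *\<^sub>R v)) {0..t}"
      by (rule fundamental_theorem_of_calculus) (use that in \<open>auto intro!: derv in_ball\<close>)
    then show ?thesis by (simp add: integral_unique)
  qed
  let ?g = "\<lambda>x. frd f x v"
  let ?h = "\<lambda>s. frd ?g (x + s *\<^sub>R v) w"
  \<comment> \<open>Both sides of \<open>ftc\<close> are differentiated at \<open>x\<close> in
    direction \<open>w\<close>. On the right this happens under the integral and uses the first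
    derivative of \<open>?g\<close> only.\<close>
  have key: "frd f (x + t *\<^sub>R v) w - frd f x w = integral {0..t} ?h" if t: "t \<in> {0..d}" for t
  proof -
    have xb: "x \<in> ball x r'" using dpos by simp
    have *: "frd (\<lambda>y. integral (cbox 0 t) (\<lambda>s. ?g (y + s *\<^sub>R v))) x w
        = integral (cbox 0 t) ?h"
    proof (rule c1_on_integral(2)[where U = "ball x r'"])
      fix y s assume ys: "y \<in> ball x r'" "s \<in> cbox 0 t"
      then have yU: "y + s *\<^sub>R v \<in> U" using t in_ball by auto
      show "((\<lambda>y. ?g (y + s *\<^sub>R v)) has_derivative blinfun_apply (frd ?g (y + s *\<^sub>R v))) (at y)"
        by (rule has_derivative_compose[of "\<lambda>y. y + s *\<^sub>R v" "\<lambda>h. h" _ _ ?g, OF _ c1_on_has_derivative[OF v yU]])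
           (auto intro!: derivative_eq_intros)
    next
      fix y assume "y \<in> ball x r'"
      then show "continuous_on (cbox 0 t) (\<lambda>s. ?g (y + s *\<^sub>R v))"
        using t by (intro continuous_on_compose2[OF c1_on_continuous[OF v]] continuous_intros)
                   (auto intro!: in_ball)
    next
      show "continuous_on (ball x r' \<times> cbox 0 t) (\<lambda>(y, s). frd ?g (y + s *\<^sub>R v))"
        unfolding split_beta using t
        by (intro continuous_on_compose2[OF c1_on_continuous_frd[OF v]] continuous_intros)
           (auto intro!: in_ball)
    qed (use xb in auto)
    have **: "((\<lambda>y. f (y + t *\<^sub>R v) - f y) has_derivative
       blinfun_apply (frd f (x + t *\<^sub>R v) - frd f x)) (at x)"
    proof -
      have "((\<lambda>y. f (y + t *\<^sub>R v)) has_derivative blinfun_apply (frd f (x + t *\<^sub>R v))) (at x)"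
        by (rule has_derivative_compose[of "\<lambda>y. y + t *\<^sub>R v" "\<lambda>h. h" x UNIV f,
              OF _ c1_on_has_derivative[OF f in_ball[OF xb t]]])
           (auto intro!: derivative_eq_intros)
      from has_derivative_diff[OF this c1_on_has_derivative[OF f x]] show ?thesis
        by (simp add: minus_blinfun.rep_eq)
    qed
    have "((\<lambda>y. integral (cbox 0 t) (\<lambda>s. ?g (y + s *\<^sub>R v))) has_derivative
       blinfun_apply (frd f (x + t *\<^sub>R v) - frd f x)) (at x)"
      by (rule has_derivative_transform_within_open[OF ** open_ball xb]) (use ftc t in auto)
    from frd_eq[OF this] * show ?thesis by (simp add: minus_blinfun.rep_eq)
  qed
  have cont: "continuous_on {0..d} ?h"
  proof -
    have "continuous_on {0..d} (\<lambda>s. frd ?g (x + s *\<^sub>R v))"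
      using dpos by (intro continuous_on_compose2[OF c1_on_continuous_frd[OF v]] continuous_intros)
                    (auto intro!: in_ball)
    then show ?thesis by (intro continuous_intros)
  qed
  \<comment> \<open>The one-sided derivative at 0 is computed twice, from the integral by the
    fundamental theorem and from \<open>w\<close> by the chain rule; uniqueness identifies the
    results.\<close>
  have "((\<lambda>t. frd f (x + t *\<^sub>R v) w - frd f x w) has_vector_derivative ?h 0) (at 0 within {0..d})"
  proof (rule has_vector_derivative_transform)
    show "((\<lambda>t. integral {0..t} ?h) has_vector_derivative ?h 0) (at 0 within {0..d})"
      by (rule integral_has_vector_derivative[OF cont]) (use dpos in auto)
  qed (use dpos key in auto)
  moreover have "((\<lambda>t. frd f (x + t *\<^sub>R v) w - frd f x w) has_vector_derivative
      frd (\<lambda>x. frd f x w) x v) (at 0 within {0..d})"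
  proof -
    have "((\<lambda>t. frd f (x + t *\<^sub>R v) w) has_derivative (\<lambda>h. frd (\<lambda>x. frd f x w) x (h *\<^sub>R v))) (at 0 within {0..d})"
      by (rule has_derivative_compose[of "\<lambda>t. x + t *\<^sub>R v" _ _ _ "\<lambda>x. frd f x w"])
         (use c1_on_has_derivative[OF w x] in \<open>auto intro!: derivative_eq_intros\<close>)
    then show ?thesis
      by (simp add: has_vector_derivative_diff_const has_vector_derivative_def blinfun.scaleR_right)
  qed
  ultimately show ?thesis
    using vector_derivative_unique_within[of 0 "{0..d}"] dpos
    by (auto simp: trivial_limit_within islimpt_Icc)
qed

subsection \<open>A mean value property\<close>

text \<open>Integrands are supported in the unit ball and get translated by vectors of norm at most
  1. Every such translate of \<open>cube 2\<close> still contains the unit ball and lies in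
  \<open>cube 3\<close>, whence the two sizes used below.\<close>

abbreviation cube :: "real \<Rightarrow> 'a::euclidean_space set" where
  "cube r \<equiv> cbox (- (r *\<^sub>R One)) (r *\<^sub>R One)"

lemma mem_cube: "y \<in> cube r \<longleftrightarrow> (\<forall>b\<in>Basis. \<bar>y \<bullet> b\<bar> \<le> r)"
  by (auto simp: mem_box abs_le_iff minus_le_iff)

lemma norm_mem_cube:
  fixes y :: "'a::euclidean_space"
  assumes "y \<in> cube r"
  shows "norm y \<le> real DIM('a) * r"
proof -
  have "norm y \<le> (\<Sum>b\<in>Basis. \<bar>y \<bullet> b\<bar>)" by (rule norm_le_l1)
  also have "\<dots> \<le> (\<Sum>b\<in>(Basis::'a set). r)" using assms by (intro sum_mono) (auto simp: mem_cube)
  finally show ?thesis by simp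
qed

text \<open>The derivative at \<open>s = 0\<close> of the integral of \<open>G (y + s e)\<close>, which does not depend on \<open>s\<close>.\<close>

lemma integral_frd_eq_0:
  fixes G :: "'a::euclidean_space \<Rightarrow> 'b::banach"
  assumes G: "c1_on V G" and V: "cube 3 \<subseteq> V"
    and supp: "\<And>y. y \<in> V \<Longrightarrow> norm y \<ge> 1 \<Longrightarrow> G y = 0" and e: "norm e \<le> 1"
  shows "integral (cube 2) (\<lambda>y. frd G y e) = 0"
proof -
  have in_V: "s *\<^sub>R e + y \<in> V" if "s \<in> {-1..1}" "y \<in> cube 2" for s y
  proof -
    have "\<bar>(s *\<^sub>R e + y) \<bullet> b\<bar> \<le> 3" if b: "b \<in> Basis" for b
    proof -
      have "\<bar>s * (e \<bullet> b)\<bar> \<le> 1 * 1"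
        unfolding abs_mult using \<open>s \<in> {-1..1}\<close> order_trans[OF Basis_le_norm[OF b] e] by (intro mult_mono) auto
      moreover have "\<bar>y \<bullet> b\<bar> \<le> 2" using \<open>y \<in> cube 2\<close> b by (auto simp: mem_cube)
      ultimately show ?thesis by (simp add: inner_add_left)
    qed
    then show ?thesis using V by (auto simp: mem_cube)
  qed
  have derv: "((\<lambda>s. G (s *\<^sub>R e + y)) has_vector_derivative frd G (s *\<^sub>R e + y) e) (at s within {-1..1})"
    if "s \<in> {-1..1}" "y \<in> cube 2" for s y
  proof -
    have "((\<lambda>s. G (s *\<^sub>R e + y)) has_derivative (\<lambda>h. frd G (s *\<^sub>R e + y) (h *\<^sub>R e))) (at s within {-1..1})"
      by (rule has_derivative_compose[of "\<lambda>s. s *\<^sub>R e + y" _ _ _ G, OF _ c1_on_has_derivative[OF G in_V[OF that]]])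
         (auto intro!: derivative_eq_intros)
    then show ?thesis by (simp add: has_vector_derivative_def blinfun.scaleR_right)
  qed
  have "((\<lambda>s. integral (cube 2) (\<lambda>y. G (s *\<^sub>R e + y))) has_vector_derivative
      integral (cube 2) (\<lambda>y. frd G (0 *\<^sub>R e + y) e)) (at 0 within {-1..1})"
  proof (rule leibniz_rule_vector_derivative)
    show "(\<lambda>y. G (s *\<^sub>R e + y)) integrable_on cube 2" if "s \<in> {-1..1}" for s
      using that
      by (intro integrable_continuous continuous_on_compose2[OF c1_on_continuous[OF G]] continuous_intros)
         (auto intro!: in_V)
    have "continuous_on ({-1..1} \<times> cube 2) (\<lambda>p. frd G (fst p *\<^sub>R e + snd p))"
      by (intro continuous_on_compose2[OF c1_on_continuous_frd[OF G]] continuous_intros)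
         (auto intro!: in_V)
    then show "continuous_on ({-1..1} \<times> cube 2) (\<lambda>(s, y). frd G (s *\<^sub>R e + y) e)"
      unfolding split_beta by (intro continuous_intros)
  qed (use derv in auto)
  \<comment> \<open>Translation turns this into an integral of \<open>G\<close> over a shifted cube,
    which still contains the unit ball; outside that ball \<open>G\<close> vanishes.\<close>
  moreover have "integral (cube 2) (\<lambda>y. G (s *\<^sub>R e + y)) = integral (cball 0 1) G" if s: "s \<in> {-1..1}" for s
  proof -
    let ?S = "cbox (- (2 *\<^sub>R One) + s *\<^sub>R e) (2 *\<^sub>R One + s *\<^sub>R e)"
    have se: "\<bar>s * (e \<bullet> b)\<bar> \<le> 1" if b: "b \<in> Basis" for b
    proof -
      have "\<bar>s * (e \<bullet> b)\<bar> \<le> 1 * 1"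
        unfolding abs_mult using s order_trans[OF Basis_le_norm[OF b] e] by (intro mult_mono) auto
      then show ?thesis by simp
    qed
    have S_V: "?S \<subseteq> V"
    proof
      fix y assume "y \<in> ?S"
      then have "y - s *\<^sub>R e \<in> cube 2" by (force simp: mem_box inner_simps)
      from in_V[OF s this] show "y \<in> V" by simp
    qed
    have sub: "cball 0 1 \<subseteq> ?S"
    proof
      fix y :: 'a assume "y \<in> cball 0 1"
      then have "\<bar>y \<bullet> b\<bar> \<le> 1" if "b \<in> Basis" for b
        using order_trans[OF Basis_le_norm[OF that]] by auto
      with se show "y \<in> ?S"
        by (fastforce simp: mem_box inner_simps abs_le_iff)
    qed
    have "integral (cube 2) (\<lambda>y. G (s *\<^sub>R e + y)) = integral ?S G"
      using integral_shift_cbox_plus[of "- (2 *\<^sub>R One)" "2 *\<^sub>R One" G "s *\<^sub>R e"] by (simp add: o_def)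
    also have "\<dots> = integral ?S (\<lambda>y. if y \<in> cball 0 1 then G y else 0)"
      by (rule integral_cong) (use S_V supp in \<open>auto simp: not_le less_imp_le\<close>)
    also have "\<dots> = integral (cball 0 1) G"
      unfolding integral_restrict_Int Int_absorb2[OF sub] ..
    finally show ?thesis .
  qed
  ultimately have "((\<lambda>s::real. integral (cball 0 1) G) has_vector_derivative
      integral (cube 2) (\<lambda>y. frd G y e)) (at 0 within {-1..1})"
    by (auto intro: has_vector_derivative_transform[rotated 2])
  from vector_derivative_unique_within[OF _ this has_vector_derivative_const] show ?thesis
    by (simp add: trivial_limit_within islimpt_Icc)
qed

text \<open>Apply \<open>integral_frd_eq_0\<close> to the product of \<open>\<psi>\<close> with the
  rescaled \<open>u\<close>. The factor \<open>r\<close> is the chain rule; the vanishing of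
  \<open>\<psi>\<close> outside the unit ball removes boundary terms.\<close>

lemma integral_by_parts_weight:
  fixes u :: "'a::euclidean_space \<Rightarrow> 'b::banach" and \<psi> :: "'a \<Rightarrow> real"
  assumes u: "c1_on U u" and U: "\<And>y. y \<in> cube 3 \<Longrightarrow> x + r *\<^sub>R y \<in> U"
    and \<psi>: "c1_on UNIV \<psi>" and supp: "\<And>y. norm y \<ge> 1 \<Longrightarrow> \<psi> y = 0" and e: "norm e \<le> 1"
  shows "r *\<^sub>R integral (cube 2) (\<lambda>y. \<psi> y *\<^sub>R frd u (x + r *\<^sub>R y) e)
    = - integral (cube 2) (\<lambda>y. frd \<psi> y e *\<^sub>R u (x + r *\<^sub>R y))"
proof -
  let ?V = "{y. x + r *\<^sub>R y \<in> U}"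
  let ?G = "\<lambda>y. \<psi> y *\<^sub>R u (x + r *\<^sub>R y)"
  let ?G' = "\<lambda>y. (\<psi> y * r) *\<^sub>R frd u (x + r *\<^sub>R y) + (blinfun_scaleR_left (u (x + r *\<^sub>R y)) o\<^sub>L frd \<psi> y)"
  have d: "(?G has_derivative blinfun_apply (?G' y)) (at y)" if "y \<in> ?V" for y
  proof -
    have "((\<lambda>y. u (x + r *\<^sub>R y)) has_derivative (\<lambda>h. frd u (x + r *\<^sub>R y) (r *\<^sub>R h))) (at y)"
      by (rule has_derivative_compose[of "\<lambda>y. x + r *\<^sub>R y" _ _ _ u, OF _ c1_on_has_derivative[OF u]])
         (use that in \<open>auto intro!: derivative_eq_intros\<close>)
    from has_derivative_scaleR[OF c1_on_has_derivative[OF \<psi> UNIV_I] this] show ?thesis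
      by (rule has_derivative_eq_rhs, intro ext) (simp add: blinfun.bilinear_simps)
  qed
  have cu: "continuous_on S (\<lambda>y. u (x + r *\<^sub>R y))" "continuous_on S (\<lambda>y. frd u (x + r *\<^sub>R y))" if "S \<subseteq> ?V" for S
    by (intro continuous_on_compose2[OF c1_on_continuous[OF u]]
          continuous_on_compose2[OF c1_on_continuous_frd[OF u]] continuous_intros; use that in auto)+
  have c\<psi>: "continuous_on S \<psi>" "continuous_on S (frd \<psi>)" for S
    using continuous_on_subset[OF c1_on_continuous[OF \<psi>]] continuous_on_subset[OF c1_on_continuous_frd[OF \<psi>]] by auto
  have G: "c1_on ?V ?G"
    by (rule c1_onI, erule d) (intro continuous_intros cu c\<psi> bounded_linear.continuous_on[OF bounded_linear_blinfun_scaleR_left]; simp)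
  have sub: "cube 2 \<subseteq> ?V" "cube 3 \<subseteq> ?V" using U by (auto simp: mem_cube) (smt (verit, best))
  have "0 = integral (cube 2) (\<lambda>y. frd ?G y e)"
    by (rule integral_frd_eq_0[OF G, symmetric]) (use sub supp e in auto)
  also have "\<dots> = integral (cube 2) (\<lambda>y. r *\<^sub>R \<psi> y *\<^sub>R frd u (x + r *\<^sub>R y) e + frd \<psi> y e *\<^sub>R u (x + r *\<^sub>R y))"
  proof (rule integral_cong)
    fix y :: 'a assume "y \<in> cube 2"
    then have "y \<in> ?V" using sub by auto
    from frd_eq[OF d[OF this]] show "frd ?G y e = r *\<^sub>R \<psi> y *\<^sub>R frd u (x + r *\<^sub>R y) e + frd \<psi> y e *\<^sub>R u (x + r *\<^sub>R y)"
      by (simp add: blinfun.bilinear_simps ac_simps)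
  qed
  also have "\<dots> = integral (cube 2) (\<lambda>y. r *\<^sub>R \<psi> y *\<^sub>R frd u (x + r *\<^sub>R y) e)
     + integral (cube 2) (\<lambda>y. frd \<psi> y e *\<^sub>R u (x + r *\<^sub>R y))"
    by (intro integral_add integrable_continuous continuous_intros cu c\<psi> sub)
  finally show ?thesis
    unfolding integral_cmul by (simp only: eq_neg_iff_add_eq_0)
qed

section \<open>The radial weight and its moments\<close>

definition bump :: "'a::euclidean_space \<Rightarrow> real" where
  "bump y = max 0 (1 - y \<bullet> y)"

lemma bump_eq_0: "norm y \<ge> 1 \<Longrightarrow> bump y = 0"
  by (simp add: bump_def dot_square_norm max_absorb1 one_le_power)

lemma continuous_bump: "continuous_on S bump"
  unfolding bump_def by (intro continuous_intros)

text \<open>Squaring smooths the corner of the maximum: \<open>bump\<close> has a kink on the unit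
  sphere, but its square is C1 and serves as the radial weight of the mean value property.\<close>

lemma has_derivative_bump_square:
  "((\<lambda>y. (bump y)\<^sup>2) has_derivative blinfun_apply ((- 4 * bump y) *\<^sub>R blinfun_inner_left y)) (at y)"
proof -
  have "((\<lambda>t::real. (max 0 t)\<^sup>2) has_real_derivative 2 * max 0 t) (at t)" for t
  proof (rule has_field_derivative_at_within[of _ _ _ UNIV, simplified], cases t "0::real" rule: linorder_cases)
    case less
    have "((\<lambda>t::real. 0) has_real_derivative 0) (at t)" by simp
    from has_field_derivative_transform_within_open[OF this, of "{..<0}" "\<lambda>t. (max 0 t)\<^sup>2"] less
    show "((\<lambda>t::real. (max 0 t)\<^sup>2) has_real_derivative 2 * max 0 t) (at t)" by simp
  next
    \<comment> \<open>At the corner the difference quotient is bounded by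
      \<open>\<bar>h\<bar>\<close>.\<close>
    case equal
    have "((\<lambda>h::real. (max 0 h)\<^sup>2 / h) \<longlongrightarrow> 0) (at 0)"
    proof (rule Lim_null_comparison)
      show "\<forall>\<^sub>F h in at 0. norm ((max 0 h)\<^sup>2 / h) \<le> \<bar>h :: real\<bar>"
        by (auto simp: max_def power2_eq_square)
      show "((\<lambda>h::real. \<bar>h\<bar>) \<longlongrightarrow> 0) (at 0)" by (rule tendsto_eq_intros refl | simp)+
    qed
    then show "((\<lambda>t::real. (max 0 t)\<^sup>2) has_real_derivative 2 * max 0 t) (at t)"
      unfolding has_field_derivative_iff equal by simp
  next
    case greater
    have "((\<lambda>t::real. t\<^sup>2) has_real_derivative 2 * t) (at t)" by (auto intro!: derivative_eq_intros)
    from has_field_derivative_transform_within_open[OF this, of "{0<..}" "\<lambda>t. (max 0 t)\<^sup>2"] greater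
    show "((\<lambda>t::real. (max 0 t)\<^sup>2) has_real_derivative 2 * max 0 t) (at t)" by simp
  qed
  then have t: "((\<lambda>t::real. (max 0 t)\<^sup>2) has_derivative (*) (2 * max 0 t)) (at t)" for t
    by (simp add: has_field_derivative_def)
  have "((\<lambda>y. 1 - y \<bullet> y) has_derivative (\<lambda>h. - 2 * (h \<bullet> y))) (at y)"
    by (auto intro!: derivative_eq_intros simp: inner_commute)
  from has_derivative_compose[OF this t] show ?thesis
    unfolding bump_def by (rule has_derivative_eq_rhs) (simp add: fun_eq_iff blinfun.bilinear_simps)
qed

lemma frd_bump_square: "frd (\<lambda>y. (bump y)\<^sup>2) y e = - 4 * bump y * (e \<bullet> y)"
  by (simp add: frd_eq[OF has_derivative_bump_square] blinfun.bilinear_simps)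

lemma c1_on_bump_square: "c1_on S (\<lambda>y. (bump y)\<^sup>2)"
  by (rule c1_onI[OF has_derivative_bump_square])
     (intro continuous_intros continuous_bump bounded_linear.continuous_on[OF bounded_linear_blinfun_inner_left])

text \<open>The derivative in direction \<open>e\<close> comes out symmetric in \<open>e\<close> and
  \<open>i\<close>, because the gradient of a radial weight is parallel to \<open>y\<close>.
  \<open>bump_moment_commute\<close> rests on this symmetry.\<close>

lemma
  shows c1_on_inner_bump: "c1_on S (\<lambda>y. (y \<bullet> i) * (bump y)\<^sup>2)"
    and frd_inner_bump: "frd (\<lambda>y. (y \<bullet> i) * (bump y)\<^sup>2) y e
      = (e \<bullet> i) * (bump y)\<^sup>2 - 4 * bump y * (y \<bullet> i) * (e \<bullet> y)"
proof -
  let ?D = "\<lambda>y. (bump y)\<^sup>2 *\<^sub>R blinfun_inner_left i + (y \<bullet> i) *\<^sub>R ((- 4 * bump y) *\<^sub>R blinfun_inner_left y)"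
  have d: "((\<lambda>y. (y \<bullet> i) * (bump y)\<^sup>2) has_derivative blinfun_apply (?D y)) (at y)" for y :: 'a
    by (rule has_derivative_eq_rhs, rule has_derivative_mult[OF _ has_derivative_bump_square])
       (auto intro!: derivative_eq_intros simp: blinfun.bilinear_simps algebra_simps)
  show "c1_on S (\<lambda>y. (y \<bullet> i) * (bump y)\<^sup>2)"
    by (rule c1_onI[OF d])
       (intro continuous_intros continuous_bump bounded_linear.continuous_on[OF bounded_linear_blinfun_inner_left])
  show "frd (\<lambda>y. (y \<bullet> i) * (bump y)\<^sup>2) y e = (e \<bullet> i) * (bump y)\<^sup>2 - 4 * bump y * (y \<bullet> i) * (e \<bullet> y)"
    by (simp add: frd_eq[OF d] blinfun.bilinear_simps)
qed

text \<open>Here \<open>i\<close> is the direction of differentiation and \<open>j\<close> the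
  coordinate in the weight. The trace over \<open>i = j\<close> is the derivative in
  \<open>r\<close> of the weighted mean of \<open>u\<close> around \<open>x\<close> at scale
  \<open>r\<close>.\<close>

definition bump_moment :: "('a::euclidean_space \<Rightarrow> 'b::banach) \<Rightarrow> 'a \<Rightarrow> real \<Rightarrow> 'a \<Rightarrow> 'a \<Rightarrow> 'b" where
  "bump_moment u x r i j = integral (cube 2) (\<lambda>y. ((y \<bullet> j) * (bump y)\<^sup>2) *\<^sub>R frd u (x + r *\<^sub>R y) i)"

text \<open>Infinitesimal form of the rotation invariance of \<open>bump\<close>.\<close>

lemma bump_moment_commute:
  assumes u: "c1_on U u" and U: "\<And>y. y \<in> cube 3 \<Longrightarrow> x + r *\<^sub>R y \<in> U"
    and "r > 0" and i: "norm i \<le> 1" and j: "norm j \<le> 1"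
  shows "bump_moment u x r i j = bump_moment u x r j i"
proof -
  have *: "r *\<^sub>R bump_moment u x r i j = - integral (cube 2) (\<lambda>y. frd (\<lambda>y. (y \<bullet> j) * (bump y)\<^sup>2) y i *\<^sub>R u (x + r *\<^sub>R y))"
    if "norm i \<le> 1" for i j
    unfolding bump_moment_def
    by (rule integral_by_parts_weight[OF u U c1_on_inner_bump _ that]) (simp_all add: bump_eq_0)
  have "r *\<^sub>R bump_moment u x r i j = r *\<^sub>R bump_moment u x r j i"
    by (simp add: *[OF i] *[OF j] frd_inner_bump inner_commute ac_simps)
  then show ?thesis using \<open>r > 0\<close> by simp
qed


section \<open>Weighted means and the gain of one derivative\<close>

lemma c1_on_weighted_integral:
  fixes u :: "'a::euclidean_space \<Rightarrow> 'b::banach" and \<kappa> :: "'a \<Rightarrow> real"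
  assumes u: "c1_on U u" and \<kappa>: "continuous_on (cube 2) \<kappa>" and W: "open W" "convex W"
    and U: "\<And>x y. x \<in> W \<Longrightarrow> y \<in> cube 2 \<Longrightarrow> x + r *\<^sub>R y \<in> U"
  shows "c1_on W (\<lambda>x. integral (cube 2) (\<lambda>y. \<kappa> y *\<^sub>R u (x + r *\<^sub>R y)))"
    and "x \<in> W \<Longrightarrow> frd (\<lambda>x. integral (cube 2) (\<lambda>y. \<kappa> y *\<^sub>R u (x + r *\<^sub>R y))) x v
      = integral (cube 2) (\<lambda>y. \<kappa> y *\<^sub>R frd u (x + r *\<^sub>R y) v)"
proof -
  have d: "((\<lambda>x. \<kappa> y *\<^sub>R u (x + r *\<^sub>R y)) has_derivative blinfun_apply (\<kappa> y *\<^sub>R frd u (x + r *\<^sub>R y))) (at x)"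
    if "x \<in> W" "y \<in> cube 2" for x y
  proof -
    have "((\<lambda>x. u (x + r *\<^sub>R y)) has_derivative (\<lambda>h. frd u (x + r *\<^sub>R y) h)) (at x)"
      by (rule has_derivative_compose[of "\<lambda>x. x + r *\<^sub>R y" "\<lambda>h. h" _ _ u, OF _ c1_on_has_derivative[OF u U[OF that]]])
         (auto intro!: derivative_eq_intros)
    from has_derivative_scaleR_right[OF this, of "\<kappa> y"] show ?thesis
      by (rule has_derivative_eq_rhs) (simp add: fun_eq_iff blinfun.bilinear_simps)
  qed
  have c: "continuous_on (cube 2) (\<lambda>y. \<kappa> y *\<^sub>R u (x + r *\<^sub>R y))" if "x \<in> W" for x
    by (intro continuous_intros \<kappa> continuous_on_compose2[OF c1_on_continuous[OF u]]) (use U that in auto)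
  have c': "continuous_on (W \<times> cube 2) (\<lambda>(x, y). \<kappa> y *\<^sub>R frd u (x + r *\<^sub>R y))"
    unfolding split_beta
    by (intro continuous_intros continuous_on_compose2[OF \<kappa>] continuous_on_compose2[OF c1_on_continuous_frd[OF u]])
       (use U in auto)
  show "c1_on W (\<lambda>x. integral (cube 2) (\<lambda>y. \<kappa> y *\<^sub>R u (x + r *\<^sub>R y)))"
    by (rule c1_on_integral(1)[OF W d c c'])
  show "frd (\<lambda>x. integral (cube 2) (\<lambda>y. \<kappa> y *\<^sub>R u (x + r *\<^sub>R y))) x v
      = integral (cube 2) (\<lambda>y. \<kappa> y *\<^sub>R frd u (x + r *\<^sub>R y) v)" if "x \<in> W"
    using c1_on_integral(2)[OF W d c c' that] by (simp add: blinfun.bilinear_simps)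
qed

text \<open>The derivative of the mean at scale \<open>s\<close> is the trace of the moments at that
  scale, which vanishes. So the mean is constant down to scale 0, where it is \<open>u x\<close>
  times the total weight.\<close>

lemma bump_mean_value:
  fixes u :: "'a::euclidean_space \<Rightarrow> 'b::banach"
  assumes u: "c1_on U u" and U: "\<And>s y. s \<in> {0..r} \<Longrightarrow> y \<in> cube 3 \<Longrightarrow> x + s *\<^sub>R y \<in> U"
    and r: "r \<ge> 0"
    and trace: "\<And>s. 0 < s \<Longrightarrow> s \<le> r \<Longrightarrow> (\<Sum>b\<in>Basis. bump_moment u x s b b) = 0"
  shows "integral (cube 2) (\<lambda>y. (bump y)\<^sup>2 *\<^sub>R u (x + r *\<^sub>R y)) = integral (cube 2) (\<lambda>y::'a. (bump y)\<^sup>2) *\<^sub>R u x"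
proof -
  let ?A = "\<lambda>s. integral (cube 2) (\<lambda>y. (bump y)\<^sup>2 *\<^sub>R u (x + s *\<^sub>R y))"
  have sub: "y \<in> cube 3" if "y \<in> cube 2" for y :: 'a
    using that by (force simp: mem_cube)
  have cu: "continuous_on S (\<lambda>p. u (x + f p *\<^sub>R g p))" "continuous_on S (\<lambda>p. frd u (x + f p *\<^sub>R g p))"
    if "continuous_on S f" "continuous_on S g" "f ` S \<subseteq> {0..r}" "g ` S \<subseteq> cube 2"
    for S f and g :: "'c::topological_space \<Rightarrow> 'a"
    using that
    by (intro continuous_on_compose2[OF c1_on_continuous[OF u]]
          continuous_on_compose2[OF c1_on_continuous_frd[OF u]] continuous_intros; auto intro!: U sub)+
  have derv: "(?A has_vector_derivative integral (cube 2) (\<lambda>y. (bump y)\<^sup>2 *\<^sub>R frd u (x + s *\<^sub>R y) y)) (at s within {0..r})"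
    if s: "s \<in> {0..r}" for s
  proof (rule leibniz_rule_vector_derivative)
    fix s and y :: 'a assume *: "s \<in> {0..r}" "y \<in> cube 2"
    have "((\<lambda>s. u (x + s *\<^sub>R y)) has_derivative (\<lambda>h. frd u (x + s *\<^sub>R y) (h *\<^sub>R y))) (at s within {0..r})"
      by (rule has_derivative_compose[of "\<lambda>s. x + s *\<^sub>R y" _ _ _ u, OF _ c1_on_has_derivative[OF u U]])
         (use * sub in \<open>auto intro!: derivative_eq_intros\<close>)
    from has_derivative_scaleR_right[OF this, of "(bump y)\<^sup>2"]
    show "((\<lambda>s. (bump y)\<^sup>2 *\<^sub>R u (x + s *\<^sub>R y)) has_vector_derivative (bump y)\<^sup>2 *\<^sub>R frd u (x + s *\<^sub>R y) y) (at s within {0..r})"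
      unfolding has_vector_derivative_def
      by (rule has_derivative_eq_rhs) (simp add: fun_eq_iff blinfun.bilinear_simps)
  next
    fix s assume "s \<in> {0..r}"
    then show "(\<lambda>y. (bump y)\<^sup>2 *\<^sub>R u (x + s *\<^sub>R y)) integrable_on cube 2"
      by (intro integrable_continuous continuous_intros continuous_bump cu) auto
  next
    show "continuous_on ({0..r} \<times> cube 2) (\<lambda>(s, y). (bump y)\<^sup>2 *\<^sub>R frd u (x + s *\<^sub>R y) y)"
      unfolding split_beta
      by (intro continuous_intros continuous_on_compose2[OF continuous_bump[of UNIV]] cu) auto
  qed (use s in auto)
  have "?A r = ?A 0"
  \<comment> \<open>The trace condition covers \<open>s > 0\<close>; scale 0 is a single exceptional
    point, where continuity of the mean suffices.\<close>
  proof (rule has_derivative_zero_unique_strong_interval[of "{0}" 0 r ?A])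
    show "continuous_on {0..r} ?A"
      using derv by (meson continuous_on_eq_continuous_within has_vector_derivative_continuous)
    show "(?A has_derivative (\<lambda>h. 0)) (at s within {0..r})" if s: "s \<in> {0..r} - {0}" for s
    proof -
      have "integral (cube 2) (\<lambda>y. (bump y)\<^sup>2 *\<^sub>R frd u (x + s *\<^sub>R y) y)
          = integral (cube 2) (\<lambda>y. \<Sum>b\<in>Basis. ((y \<bullet> b) * (bump y)\<^sup>2) *\<^sub>R frd u (x + s *\<^sub>R y) b)"
      proof (rule integral_cong)
        fix y :: 'a
        have "frd u (x + s *\<^sub>R y) y = frd u (x + s *\<^sub>R y) (\<Sum>b\<in>Basis. (y \<bullet> b) *\<^sub>R b)"
          by (simp add: euclidean_representation)
        then show "(bump y)\<^sup>2 *\<^sub>R frd u (x + s *\<^sub>R y) y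
            = (\<Sum>b\<in>Basis. ((y \<bullet> b) * (bump y)\<^sup>2) *\<^sub>R frd u (x + s *\<^sub>R y) b)"
          by (simp add: blinfun.sum_right blinfun.scaleR_right scaleR_sum_right mult.commute)
      qed
      also have "\<dots> = (\<Sum>b\<in>Basis. bump_moment u x s b b)"
        unfolding bump_moment_def using s
        by (intro integral_sum integrable_continuous continuous_intros continuous_bump cu) auto
      also have "\<dots> = 0" using trace s by auto
      finally show ?thesis
        using derv[of s] s by (auto simp: has_vector_derivative_def)
    qed
  qed (use r in auto)
  then show ?thesis
    by (simp add: integral_linear[OF _ bounded_linear_scaleR_left, unfolded o_def, symmetric]
        integrable_continuous continuous_intros continuous_bump)
qed

lemma integral_bump_square_pos: "integral (cube 2) (\<lambda>y::'a::euclidean_space. (bump y)\<^sup>2) > 0"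
proof -
  have c: "continuous_on (cube 2) (\<lambda>y::'a. (bump y)\<^sup>2)"
    by (intro continuous_intros continuous_bump)
  have "0 \<in> cube 2 \<and> (bump (0::'a))\<^sup>2 \<noteq> 0" by (simp add: mem_cube bump_def)
  moreover have "box (- (2 *\<^sub>R One)) (2 *\<^sub>R One :: 'a) \<noteq> {}" by (simp add: box_ne_empty)
  ultimately have "integral (cube 2) (\<lambda>y::'a. (bump y)\<^sup>2) \<noteq> 0"
    by (subst integral_cbox_eq_0_iff[OF c]) auto
  moreover have "integral (cube 2) (\<lambda>y::'a. (bump y)\<^sup>2) \<ge> 0"
    by (intro integral_nonneg integrable_continuous c) auto
  ultimately show ?thesis by linarith
qed

text \<open>Moving the derivative from \<open>u\<close> to the weight in the mean value formula gains one order of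
  differentiability.\<close>

lemma c1_on_frd:
  fixes u :: "'a::euclidean_space \<Rightarrow> 'b::banach"
  assumes "open U" and u: "c1_on U u" and e: "norm e \<le> 1"
    and trace: "\<And>x s. 0 < s \<Longrightarrow> (\<And>y. y \<in> cube 3 \<Longrightarrow> x + s *\<^sub>R y \<in> U) \<Longrightarrow>
      (\<Sum>b\<in>Basis. bump_moment u x s b b) = 0"
  shows "c1_on U (\<lambda>x. frd u x e)"
proof (rule c1_on_local)
  fix x0 assume "x0 \<in> U"
  then obtain R where R: "R > 0" "ball x0 R \<subseteq> U"
    using \<open>open U\<close> openE by blast
  define W where "W = ball x0 (R / 2)"
  \<comment> \<open>\<open>d\<close> bounds the norm on \<open>cube 3\<close>, and \<open>r\<close>
    satisfies \<open>r * d < R / 2\<close>. Hence around every centre in the half-size ball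
    \<open>W\<close> all scales up to \<open>r\<close> stay inside \<open>U\<close>.\<close>
  define d where "d = real DIM('a) * 3"
  define r where "r = R / (2 * (d + 1))"
  have d: "d > 0" by (simp add: d_def)
  have r: "r > 0" using R d by (simp add: r_def)
  have W: "open W" "convex W" "x0 \<in> W" using R by (auto simp: W_def)
  have U: "x + s *\<^sub>R y \<in> U" if "x \<in> W" "s \<in> {0..r}" "y \<in> cube 3" for x s y
  proof -
    have "norm (s *\<^sub>R y) \<le> r * d"
      using that norm_mem_cube[OF that(3)] unfolding norm_scaleR d_def by (intro mult_mono) auto
    also have "\<dots> < r * (d + 1)" using r by simp
    also have "\<dots> = R / 2" using d by (simp add: r_def field_simps)
    finally have "dist x0 (x + s *\<^sub>R y) < R"
      using that norm_triangle_ineq4[of "x0 - x" "s *\<^sub>R y"]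
      by (auto simp: dist_norm W_def algebra_simps)
    then show ?thesis using R by auto
  qed
  have U2: "x + r *\<^sub>R y \<in> U" if "x \<in> W" "y \<in> cube 2" for x y
    by (rule U) (use that r in \<open>force simp: mem_cube\<close>)+
  define c where "c = integral (cube 2) (\<lambda>y::'a. (bump y)\<^sup>2)"
  have c: "c > 0" unfolding c_def by (rule integral_bump_square_pos)
  let ?I = "\<lambda>x. integral (cube 2) (\<lambda>y. (bump y)\<^sup>2 *\<^sub>R u (x + r *\<^sub>R y))"
  have I: "?I x = c *\<^sub>R u x" if "x \<in> W" for x
    unfolding c_def
  proof (rule bump_mean_value[OF u])
    show "(\<Sum>b\<in>Basis. bump_moment u x s b b) = 0" if "0 < s" "s \<le> r" for s
      by (rule trace) (use U \<open>x \<in> W\<close> that in auto)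
  qed (use U that r in auto)
  have cW: "continuous_on (cube 2) (\<lambda>y::'a. (bump y)\<^sup>2)" "continuous_on (cube 2) (\<lambda>y. bump y * (e \<bullet> y))"
    by (intro continuous_intros continuous_bump)+
  \<comment> \<open>Up to the factor -4 the weight in \<open>?K\<close> is the derivative of
    \<open>(bump y)\<^sup>2\<close> in direction \<open>e\<close>: this is the mean after the
    derivative has been moved off \<open>u\<close>.\<close>
  let ?K = "\<lambda>x. integral (cube 2) (\<lambda>y. (bump y * (e \<bullet> y)) *\<^sub>R u (x + r *\<^sub>R y))"
  have K: "(4 / (c * r)) *\<^sub>R ?K x = frd u x e" if x: "x \<in> W" for x
  proof -
    have d: "((\<lambda>x. c *\<^sub>R u x) has_derivative blinfun_apply (c *\<^sub>R frd u x)) (at x)"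
    proof -
      have "x \<in> U" using U2[OF x, of 0] by (simp add: mem_cube)
      from has_derivative_scaleR_right[OF c1_on_has_derivative[OF u this], of c] show ?thesis
        by (rule has_derivative_eq_rhs, intro ext) (simp add: blinfun.bilinear_simps)
    qed
    have "frd ?I x = c *\<^sub>R frd u x"
      by (rule frd_eq, rule has_derivative_transform_within_open[OF d W(1) x]) (simp add: I)
    then have "c *\<^sub>R frd u x e = frd ?I x e" by (simp add: blinfun.bilinear_simps)
    then have "r *\<^sub>R c *\<^sub>R frd u x e = r *\<^sub>R integral (cube 2) (\<lambda>y. (bump y)\<^sup>2 *\<^sub>R frd u (x + r *\<^sub>R y) e)"
      using c1_on_weighted_integral(2)[OF u cW(1) W(1,2) U2 x] by simp
    also have "\<dots> = - integral (cube 2) (\<lambda>y. frd (\<lambda>y. (bump y)\<^sup>2) y e *\<^sub>R u (x + r *\<^sub>R y))"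
      by (rule integral_by_parts_weight[OF u _ c1_on_bump_square _ e])
         (use U[OF x] r in \<open>auto simp: bump_eq_0\<close>)
    also have "\<dots> = integral (cube 2) (\<lambda>y. 4 *\<^sub>R (bump y * (e \<bullet> y)) *\<^sub>R u (x + r *\<^sub>R y))"
      by (simp add: frd_bump_square mult.assoc flip: integral_neg)
    also have "\<dots> = 4 *\<^sub>R ?K x" by (rule integral_cmul)
    finally have "(4 / (c * r)) *\<^sub>R ?K x = (1 / (c * r)) *\<^sub>R (r *\<^sub>R c *\<^sub>R frd u x e)"
      by simp
    then show ?thesis using c r by simp
  qed
  \<comment> \<open>The weight in \<open>?K\<close> is merely continuous; differentiation of
    \<open>?K\<close> in \<open>x\<close> falls on \<open>u\<close>, which is C1.\<close>
  have "c1_on W (\<lambda>x. (4 / (c * r)) *\<^sub>R ?K x)"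
    by (rule c1_on_bounded_linear[OF c1_on_weighted_integral(1)[OF u cW(2) W(1,2) U2] bounded_linear_scaleR_right])
  then have "c1_on W (\<lambda>x. frd u x e)"
    by (rule c1_on_cong[OF W(1), rotated]) (simp add: K)
  then show "\<exists>V. open V \<and> x0 \<in> V \<and> c1_on V (\<lambda>x. frd u x e)"
    using W by blast
qed

subsection \<open>Partial derivatives and the operators \<open>nabla\<close>\<close>

definition ax :: "nat \<Rightarrow> ('n::finite) hvec" where
  "ax m = axis (of_nat m) 1"

lemma pd_eq_frd:
  assumes "\<phi> differentiable (at x)"
  shows "pd m \<phi> x = frd \<phi> x (ax m)"
proof -
  have "((\<lambda>s. \<phi> (x + s *\<^sub>R ax m)) has_derivative (\<lambda>h. frd \<phi> x (h *\<^sub>R ax m))) (at 0)"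
    by (rule has_derivative_compose[of "\<lambda>s. x + s *\<^sub>R ax m" _ _ _ \<phi>])
       (use frd_works[OF assms] in \<open>auto intro!: derivative_eq_intros\<close>)
  then have "((\<lambda>s. \<phi> (x + s *\<^sub>R ax m)) has_vector_derivative frd \<phi> x (ax m)) (at 0)"
    by (simp add: has_vector_derivative_def blinfun.scaleR_right)
  then show ?thesis unfolding pd_def ax_def by (rule vector_derivative_at)
qed

lemma Basis_hvec: "(Basis :: ('n::finite) hvec set) = ax ` {..<4 * CARD('n)}"
proof -
  have "(Basis :: 'n hvec set) = (\<lambda>i. axis i 1) ` UNIV"
    by (auto simp: Basis_vec_def)
  also have "UNIV = (of_nat :: nat \<Rightarrow> 'n bit0 bit0) ` {..<4 * CARD('n)}"
    using of_nat_bit0_bij[where 'n = 'n] by (simp add: bij_betw_def)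
  finally show ?thesis by (simp add: image_image ax_def)
qed

lemma of_nat_bit0_eq_iff:
  "m < 4 * CARD('n) \<Longrightarrow> l < 4 * CARD('n) \<Longrightarrow> (of_nat m :: ('n::finite) bit0 bit0) = of_nat l \<longleftrightarrow> m = l"
  using of_nat_bit0_bij[where 'n = 'n] by (auto simp: bij_betw_def inj_on_def)

lemma inj_on_ax: "inj_on (ax :: nat \<Rightarrow> ('n::finite) hvec) {..<4 * CARD('n)}"
  by (rule inj_onI) (simp add: ax_def axis_eq_axis of_nat_bit0_eq_iff)

lemma sum_Basis_hvec:
  "(\<Sum>b\<in>(Basis :: ('n::finite) hvec set). F b)
    = (\<Sum>t<CARD('n). F (ax (4*t)) + F (ax (4*t+1)) + F (ax (4*t+2)) + F (ax (4*t+3)))"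
proof -
  have *: "(\<Sum>m<4 * N. G m) = (\<Sum>t<N. G (4*t) + G (4*t+1) + G (4*t+2) + G (4*t+3))"
    for N and G :: "nat \<Rightarrow> 'b::comm_monoid_add"
    by (induction N) (simp_all add: eval_nat_numeral algebra_simps)
  show ?thesis
    unfolding Basis_hvec sum.reindex[OF inj_on_ax] o_def by (rule *)
qed

text \<open>In finite dimension an operator-valued map is continuous as soon as its values on basis
  vectors are, and here those values are the partial derivatives.\<close>

lemma C_on_1_iff: "C_on 1 U \<phi> \<longleftrightarrow> c1_on U \<phi>"
proof
  assume C: "C_on 1 U \<phi>"
  have "continuous_on U (frd \<phi>)"
  proof (rule continuous_on_blinfun_componentwise)
    fix i :: "'a hvec" assume "i \<in> Basis"
    then obtain m where m: "m < 4 * CARD('a)" "i = ax m" by (auto simp: Basis_hvec)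
    then have "continuous_on U (pd m \<phi>)" using C by simp
    then show "continuous_on U (\<lambda>x. frd \<phi> x i)"
      by (rule continuous_on_cong[THEN iffD1, rotated -1]) (use C m in \<open>simp_all add: pd_eq_frd\<close>)
  qed
  then show "c1_on U \<phi>" using C by (simp add: c1_on_def)
next
  assume c: "c1_on U \<phi>"
  have "continuous_on U (pd m \<phi>)" for m
    using blinfun.continuous_on[OF c1_on_continuous_frd[OF c] continuous_on_const[of U "ax m"]]
    by (rule continuous_on_cong[THEN iffD1, rotated -1]) (use c in \<open>simp_all add: pd_eq_frd c1_on_def\<close>)
  then show "C_on 1 U \<phi>" using c by (simp add: c1_on_def)
qed

section \<open>Functions of class C2 and commuting derivatives\<close>

definition c2_on :: "('n::finite) hvec set \<Rightarrow> ('n hvec \<Rightarrow> complex) \<Rightarrow> bool" where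
  "c2_on U \<phi> \<longleftrightarrow> c1_on U \<phi> \<and> (\<forall>m<4 * CARD('n). c1_on U (pd m \<phi>))"

lemma C_on_2_iff: "C_on 2 U \<phi> \<longleftrightarrow> c2_on U \<phi>"
proof -
  have *: "C_on 2 U \<phi> \<longleftrightarrow> (\<forall>x\<in>U. \<phi> differentiable (at x)) \<and> (\<forall>m<4 * CARD('a). c1_on U (pd m \<phi>))"
    unfolding numeral_2_eq_2 C_on.simps(2)[of "Suc 0"] C_on_1_iff[unfolded One_nat_def] ..
  have "c1_on U \<phi>" if "C_on 2 U \<phi>"
    unfolding C_on_1_iff[symmetric] One_nat_def C_on.simps using that c1_on_continuous by (auto simp: *)
  then show ?thesis by (auto simp: * c2_on_def c1_on_def)
qed

lemma pd_cong_open: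
  assumes "open U" "x \<in> U" "\<And>y. y \<in> U \<Longrightarrow> \<phi> y = \<psi> y"
  shows "pd m \<phi> x = pd m \<psi> x"
proof -
  have "open ((\<lambda>s. x + s *\<^sub>R ax m) -` U)"
    by (intro open_vimage assms continuous_intros)
  then have "\<forall>\<^sub>F s in nhds 0. x + s *\<^sub>R ax m \<in> U"
    using assms(2) by (auto simp: eventually_nhds)
  then have "\<forall>\<^sub>F s in nhds 0. \<phi> (x + s *\<^sub>R ax m) = \<psi> (x + s *\<^sub>R ax m)"
    by eventually_elim (rule assms(3))
  then show ?thesis
    unfolding pd_def ax_def[symmetric] by (intro vector_derivative_cong_eq) auto
qed

lemma pd_commute:
  assumes "open U" "c2_on U \<phi>" "x \<in> U" "m < 4 * CARD('n)" "l < 4 * CARD('n)"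
  shows "pd m (pd l \<phi>) x = pd l (pd m \<phi>) (x :: ('n::finite) hvec)"
proof -
  have c: "c1_on U \<phi>" "c1_on U (pd j \<phi>)" if "j \<in> {m, l}" for j
    using assms that by (auto simp: c2_on_def)
  have eq: "pd j \<phi> y = frd \<phi> y (ax j)" if "y \<in> U" for j y
    using c(1)[of m] that by (auto simp: c1_on_def pd_eq_frd)
  have c': "c1_on U (\<lambda>y. frd \<phi> y (ax j))" if "j \<in> {m, l}" for j
    by (rule c1_on_cong[OF \<open>open U\<close> _ c(2)[OF that]]) (simp add: eq)
  have *: "pd i (pd j \<phi>) x = frd (\<lambda>y. frd \<phi> y (ax j)) x (ax i)" if "j \<in> {m, l}" for i j
  proof -
    have "pd i (pd j \<phi>) x = pd i (\<lambda>y. frd \<phi> y (ax j)) x"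
      by (rule pd_cong_open[OF assms(1,3) eq])
    with c'[OF that] \<open>x \<in> U\<close> show ?thesis by (simp add: c1_on_def pd_eq_frd)
  qed
  show ?thesis
    using frd_commute[OF \<open>open U\<close> c(1) c'[of l] c'[of m] \<open>x \<in> U\<close>, of m] by (simp add: *)
qed

text \<open>Each operator differentiates in two coordinates of the single quaternion with index
  \<open>A div 2\<close>. The rules for \<open>nabla\<close> thereby reduce to those for
  \<open>pd\<close>, and the two conditions on \<open>div\<close> later give one common factor under
  rescaling of q_0.\<close>

lemma nabla_coeffs:
  assumes "A < 2 * CARD('n)"
  obtains p q m l where "m < 4 * CARD('n)" "l < 4 * CARD('n)" "m div 4 = A div 2" "l div 4 = A div 2"
    "\<And>\<phi> x. nabla A a \<phi> (x :: ('n::finite) hvec) = p * pd m \<phi> x + q * pd l \<phi> x"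
proof -
  define t where "t = A div 2"
  have t: "t < CARD('n)" "t = A div 2" using assms by (auto simp: t_def)
  have "\<exists>p q m l. m < 4 * CARD('n) \<and> l < 4 * CARD('n) \<and> m div 4 = t \<and> l div 4 = t \<and>
    (\<forall>\<phi> x. nabla A a \<phi> (x :: 'n hvec) = p * pd m \<phi> x + q * pd l \<phi> x)"
  proof (cases "even A"; cases a)
    assume "even A" "a = P0"
    then show ?thesis
      by (intro exI[of _ "-1"] exI[of _ "-\<i>"] exI[of _ "4*t+2"] exI[of _ "4*t+3"])
         (use t in \<open>auto simp: nabla_def\<close>)
  next
    assume "even A" "a = P1"
    then show ?thesis
      by (intro exI[of _ "-1"] exI[of _ "-\<i>"] exI[of _ "4*t"] exI[of _ "4*t+1"])
         (use t in \<open>auto simp: nabla_def\<close>)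
  next
    assume "odd A" "a = P0"
    then show ?thesis
      by (intro exI[of _ "1"] exI[of _ "-\<i>"] exI[of _ "4*t"] exI[of _ "4*t+1"])
         (use t in \<open>auto simp: nabla_def Let_def\<close>)
  next
    assume "odd A" "a = P1"
    then show ?thesis
      by (intro exI[of _ "-1"] exI[of _ "\<i>"] exI[of _ "4*t+2"] exI[of _ "4*t+3"])
         (use t in \<open>auto simp: nabla_def Let_def\<close>)
  qed
  then show ?thesis using that t by auto
qed

lemma nabla_cong_open:
  assumes "open U" "x \<in> U" "\<And>y. y \<in> U \<Longrightarrow> \<phi> y = \<psi> y"
  shows "nabla A a \<phi> x = nabla A a \<psi> x"
proof -
  have "pd m \<phi> x = pd m \<psi> x" for m by (rule pd_cong_open[OF assms])
  then show ?thesis by (simp add: nabla_def Let_def split: pidx.split)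
qed

lemma pd_0: "pd m (\<lambda>x. 0) x = 0"
  unfolding pd_def by (simp add: vector_derivative_const_at)

lemma nabla_0: "nabla A a (\<lambda>x. 0) x = 0"
  by (simp add: nabla_def pd_0 Let_def split: pidx.split)

lemma pd_cmult:
  assumes "\<phi> differentiable (at x)"
  shows "pd m (\<lambda>y. c * \<phi> y) x = c * pd m \<phi> x"
proof -
  have "((\<lambda>y. c * \<phi> y) has_derivative blinfun_apply (blinfun_mult_right c o\<^sub>L frd \<phi> x)) (at x)"
    using has_derivative_mult_right[OF frd_works[OF assms], of c]
    by (rule has_derivative_eq_rhs) (simp add: fun_eq_iff)
  from frd_eq[OF this] this assms show ?thesis
    by (simp add: pd_eq_frd differentiable_def[of "\<lambda>y. c * \<phi> y"] exI)
qed

lemma pd_add: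
  assumes "\<phi> differentiable (at x)" "\<psi> differentiable (at x)"
  shows "pd m (\<lambda>y. \<phi> y + \<psi> y) x = pd m \<phi> x + pd m \<psi> x"
proof -
  have "((\<lambda>y. \<phi> y + \<psi> y) has_derivative blinfun_apply (frd \<phi> x + frd \<psi> x)) (at x)"
    using has_derivative_add[OF assms[THEN frd_works]]
    by (rule has_derivative_eq_rhs) (simp add: fun_eq_iff blinfun.bilinear_simps)
  from frd_eq[OF this] assms show ?thesis
    by (simp add: pd_eq_frd blinfun.bilinear_simps)
qed

lemma nabla_cmult:
  assumes "\<phi> differentiable (at x)"
  shows "nabla A a (\<lambda>y. c * \<phi> y) x = c * nabla A a \<phi> x"
  by (simp add: nabla_def pd_cmult[OF assms] Let_def algebra_simps split: pidx.split)

lemma c1_on_cmult: "c1_on U \<phi> \<Longrightarrow> c1_on U (\<lambda>x. c * \<phi> x :: complex)"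
  by (rule c1_on_bounded_linear[OF _ bounded_linear_mult_right])

lemma c1_on_nabla:
  assumes "c2_on U \<phi>" "A < 2 * CARD('n)"
  shows "c1_on (U :: ('n::finite) hvec set) (nabla A a \<phi>)"
proof -
  obtain p q m l where *: "m < 4 * CARD('n)" "l < 4 * CARD('n)"
    "\<And>\<phi> x. nabla A a \<phi> (x :: 'n hvec) = p * pd m \<phi> x + q * pd l \<phi> x"
    using nabla_coeffs[OF assms(2)] by metis
  have "c1_on U (\<lambda>x. p * pd m \<phi> x + q * pd l \<phi> x)"
    by (intro c1_on_add c1_on_cmult) (use * assms in \<open>auto simp: c2_on_def\<close>)
  then show ?thesis by (simp add: *(3)[abs_def])
qed

lemma nabla_commute:
  assumes "open U" "c2_on U \<phi>" "x \<in> U" "A < 2 * CARD('n)" "B < 2 * CARD('n)"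
  shows "nabla A a (nabla B b \<phi>) x = nabla B b (nabla A a \<phi>) (x :: ('n::finite) hvec)"
proof -
  obtain p q m l where A: "m < 4 * CARD('n)" "l < 4 * CARD('n)"
    "\<And>\<phi> x. nabla A a \<phi> (x :: 'n hvec) = p * pd m \<phi> x + q * pd l \<phi> x"
    using nabla_coeffs[OF assms(4)] by metis
  obtain p' q' m' l' where B: "m' < 4 * CARD('n)" "l' < 4 * CARD('n)"
    "\<And>\<phi> x. nabla B b \<phi> (x :: 'n hvec) = p' * pd m' \<phi> x + q' * pd l' \<phi> x"
    using nabla_coeffs[OF assms(5)] by metis
  have d: "pd j \<phi> differentiable (at x)" if "j < 4 * CARD('n)" for j
    using assms that by (auto simp: c2_on_def c1_on_def)
  have *: "pd i (\<lambda>y. r * pd j \<phi> y + s * pd k \<phi> y) x = r * pd i (pd j \<phi>) x + s * pd i (pd k \<phi>) x"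
    if "j < 4 * CARD('n)" "k < 4 * CARD('n)" for i j k r s
    using d that by (simp add: pd_add pd_cmult differentiable_mult)
  show ?thesis
    unfolding A(3)[abs_def] B(3)[abs_def]
    using pd_commute[OF assms(1-3)] A(1,2) B(1,2) by (simp add: * algebra_simps)
qed

subsection \<open>Regular functions in terms of \<open>nabla\<close>\<close>

lemma dform_form0:
  "dform a (form0 \<phi>) x J = (\<Sum>A<2 * CARD('n). if J = {A} then nabla A a \<phi> x else 0)"
  for x :: "('n::finite) hvec"
  unfolding dform_def
proof (rule sum.cong[OF refl])
  fix A
  have "(\<Sum>I\<in>Pow {..<2 * CARD('n)}. nabla A a (\<lambda>y. form0 \<phi> y I) x * wedge A I J)
      = (\<Sum>I\<in>{{}}. nabla A a (\<lambda>y. form0 \<phi> y I) x * wedge A I J)"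
    by (rule sum.mono_neutral_right) (auto simp: form0_def nabla_0)
  then show "(\<Sum>I\<in>Pow {..<2 * CARD('n)}. nabla A a (\<lambda>y. form0 \<phi> y I) x * wedge A I J)
      = (if J = {A} then nabla A a \<phi> x else 0)"
    by (simp add: form0_def wedge_def)
qed

lemma dform_form0_singleton:
  "B < 2 * CARD('n) \<Longrightarrow> dform a (form0 \<phi>) x {B} = nabla B a \<phi> x"
  for x :: "('n::finite) hvec"
  by (simp add: dform_form0 singleton_insert_inj_eq' sum.delta)

text \<open>The equation between one-forms is read off coefficient by coefficient: each
  \<open>{B}\<close> with \<open>B\<close> in range gives one scalar equation, and all other
  coefficients are zero.\<close>

lemma regular_Suc_iff:
  "f \<in> regular (Suc k) (U :: ('n::finite) hvec set) \<longleftrightarrow>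
    (\<forall>x\<in>U. f x \<in> sympow (Suc k)) \<and>
    (\<forall>As. length As = Suc k \<longrightarrow> c1_on U (\<lambda>x. f x As)) \<and>
    (\<forall>As. length As = k \<longrightarrow> (\<forall>x\<in>U. \<forall>B<2 * CARD('n).
      nabla B P0 (\<lambda>y. f y (P0 # As)) x + nabla B P1 (\<lambda>y. f y (P1 # As)) x = 0))"
proof -
  have "(\<forall>J. dform P0 (form0 \<phi>) x J + dform P1 (form0 \<psi>) x J = 0) \<longleftrightarrow>
      (\<forall>B<2 * CARD('n). nabla B P0 \<phi> x + nabla B P1 \<psi> x = 0)"
    for \<phi> \<psi> and x :: "'n hvec"
  proof
    assume "\<forall>J. dform P0 (form0 \<phi>) x J + dform P1 (form0 \<psi>) x J = 0"
    then show "\<forall>B<2 * CARD('n). nabla B P0 \<phi> x + nabla B P1 \<psi> x = 0"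
      by (metis dform_form0_singleton)
  next
    assume "\<forall>B<2 * CARD('n). nabla B P0 \<phi> x + nabla B P1 \<psi> x = 0"
    then show "\<forall>J. dform P0 (form0 \<phi>) x J + dform P1 (form0 \<psi>) x J = 0"
      by (auto simp: dform_form0 simp flip: sum.distrib intro!: sum.neutral)
  qed
  then show ?thesis by (simp add: C_on_1_iff[simplified])
qed

text \<open>This is the coefficient at \<open>{A, B}\<close> of the two-form in the definition of
  0-regularity. It arises from adding \<open>A\<close> to \<open>{B}\<close> or \<open>B\<close> to
  \<open>{A}\<close>; since \<open>A < B\<close>, only the latter has to pass a smaller index and
  carries a minus sign.\<close>

lemma regular_0_nabla:
  assumes f: "f \<in> regular 0 U" and x: "x \<in> U" and AB: "A < B" "B < 2 * CARD('n)"
  shows "nabla A P0 (nabla B P1 (\<lambda>y. f y [])) x = nabla B P0 (nabla A P1 (\<lambda>y. f y [])) (x :: ('n::finite) hvec)"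
proof -
  let ?\<phi> = "\<lambda>y. f y []" and ?N = "2 * CARD('n)"
  let ?g = "\<lambda>C I. nabla C P0 (\<lambda>y. dform P1 (form0 ?\<phi>) y I) x * wedge C I {A, B}"
  have 0: "(\<Sum>I\<in>Pow {..<?N}. ?g C I) = (if C \<in> {A, B} then ?g C ({A, B} - {C}) else 0)" for C
  proof (cases "C \<in> {A, B}")
    case True
    have "(\<Sum>I\<in>Pow {..<?N}. ?g C I) = (\<Sum>I\<in>{{A, B} - {C}}. ?g C I)"
    proof (rule sum.mono_neutral_right)
      show "\<forall>I\<in>Pow {..<?N} - {{A, B} - {C}}. ?g C I = 0"
        by (auto simp: wedge_def)
    qed (use AB in auto)
    with True show ?thesis by simp
  next
    case False
    then have "wedge C I {A, B} = 0" for I by (auto simp: wedge_def)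
    with False show ?thesis by simp
  qed
  have "0 = dform P0 (dform P1 (form0 ?\<phi>)) x {A, B}"
    using f x by simp
  also have "\<dots> = (\<Sum>C<?N. if C \<in> {A, B} then ?g C ({A, B} - {C}) else 0)"
    unfolding dform_def[of P0] by (simp only: 0)
  also have "\<dots> = (\<Sum>C\<in>{A, B}. ?g C ({A, B} - {C}))"
    using AB by (subst sum.inter_restrict[symmetric]) (auto intro!: sum.cong)
  also have "\<dots> = ?g A {B} + ?g B {A}"
    using AB by (simp add: insert_Diff_if)
  also have "\<dots> = nabla A P0 (nabla B P1 ?\<phi>) x - nabla B P0 (nabla A P1 ?\<phi>) x"
  proof -
    have "{C \<in> {B}. C < A} = {}" "{C \<in> {A}. C < B} = {A}" using AB by auto
    then have "card {C \<in> {B}. C < A} = 0" "card {C \<in> {A}. C < B} = 1" by simp_all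
    moreover have "A \<notin> {B}" "B \<notin> {A}" "{A, B} = insert B {A}" using AB by auto
    ultimately have "wedge A {B} {A, B} = 1" "wedge B {A} {A, B} = -1"
      unfolding wedge_def by (simp_all only: simp_thms if_True power_0 power_one_right)
    moreover have "(\<lambda>y. dform P1 (form0 ?\<phi>) y {C}) = nabla C P1 ?\<phi>" if "C < ?N" for C
      using that by (simp add: dform_form0_singleton fun_eq_iff)
    ultimately show ?thesis using AB by simp
  qed
  finally show ?thesis by simp
qed


subsection \<open>Regularity of higher order\<close>

text \<open>The moments behave like a symmetric matrix of second derivatives. The combinations of
  regularity equations that would show a C2 solution to be harmonic in each quaternion separately
  therefore make the trace over each quaternion vanish, with \<open>u\<close> and \<open>v\<close>
  only C1.\<close>

lemma sum_bump_moment_eq_0: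
  fixes u v :: "('n::finite) hvec \<Rightarrow> complex"
  assumes u: "c1_on U u" and v: "c1_on U v"
    and eq: "\<And>x B. x \<in> U \<Longrightarrow> B < 2 * CARD('n) \<Longrightarrow> nabla B P0 u x + nabla B P1 v x = 0"
    and s: "s > 0" and U: "\<And>y. y \<in> cube 3 \<Longrightarrow> x + s *\<^sub>R y \<in> U"
  shows "(\<Sum>b\<in>Basis. bump_moment u x s b b) = 0" and "(\<Sum>b\<in>Basis. bump_moment v x s b b) = 0"
proof -
  define Mu where "Mu i j = bump_moment u x s (ax i) (ax j)" for i j
  define Mv where "Mv i j = bump_moment v x s (ax i) (ax j)" for i j
  have n: "norm (ax m :: 'n hvec) \<le> 1" for m by (simp add: ax_def)
  have sym: "Mu i j = Mu j i" "Mv i j = Mv j i" for i j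
    unfolding Mu_def Mv_def
    by (rule bump_moment_commute[OF u U s n n] bump_moment_commute[OF v U s n n]; assumption)+
  have U2: "x + s *\<^sub>R y \<in> U" if "y \<in> cube 2" for y
    by (rule U) (use that in \<open>force simp: mem_cube\<close>)
  have c: "continuous_on (cube 2) (\<lambda>y. frd u (x + s *\<^sub>R y) e)" "continuous_on (cube 2) (\<lambda>y. frd v (x + s *\<^sub>R y) e)" for e
    by (intro continuous_intros continuous_on_compose2[OF c1_on_continuous_frd[OF u]]
        continuous_on_compose2[OF c1_on_continuous_frd[OF v]]; use U2 in auto)+
  \<comment> \<open>A pointwise linear relation between partial derivatives becomes one between
    moments, by integration against the weight with index \<open>j\<close>.\<close>
  have lin: "p1 * Mu m1 j + q1 * Mu l1 j + (p2 * Mv m2 j + q2 * Mv l2 j) = 0"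
    if z: "\<And>y. y \<in> U \<Longrightarrow> p1 * pd m1 u y + q1 * pd l1 u y + (p2 * pd m2 v y + q2 * pd l2 v y) = 0"
    for p1 q1 p2 q2 m1 l1 m2 l2 j
  proof -
    let ?w = "\<lambda>y. (y \<bullet> ax j) * (bump y)\<^sup>2"
    let ?u = "\<lambda>m y. ?w y *\<^sub>R frd u (x + s *\<^sub>R y) (ax m)"
    let ?v = "\<lambda>m y. ?w y *\<^sub>R frd v (x + s *\<^sub>R y) (ax m)"
    have i: "?u m integrable_on cube 2" "?v m integrable_on cube 2" for m
      by (intro integrable_continuous continuous_intros continuous_bump c)+
    have "p1 * Mu m1 j + q1 * Mu l1 j + (p2 * Mv m2 j + q2 * Mv l2 j)
        = integral (cube 2) (\<lambda>y. p1 * ?u m1 y + q1 * ?u l1 y + (p2 * ?v m2 y + q2 * ?v l2 y))"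
      unfolding Mu_def Mv_def bump_moment_def
      by (simp only: integral_add integral_mult_right integrable_on_mult_right integrable_add i)
    also have "\<dots> = integral (cube 2) (\<lambda>y :: 'n hvec. 0)"
    proof (rule integral_cong)
      fix y :: "'n hvec" assume "y \<in> cube 2"
      then have y: "x + s *\<^sub>R y \<in> U" by (rule U2)
      have "p1 * ?u m1 y + q1 * ?u l1 y + (p2 * ?v m2 y + q2 * ?v l2 y)
        = ?w y *\<^sub>R (p1 * pd m1 u (x + s *\<^sub>R y) + q1 * pd l1 u (x + s *\<^sub>R y)
            + (p2 * pd m2 v (x + s *\<^sub>R y) + q2 * pd l2 v (x + s *\<^sub>R y)))"
        using u v y by (simp add: pd_eq_frd c1_on_def algebra_simps)
      also have "\<dots> = 0" using z[OF y] by simp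
      finally show "p1 * ?u m1 y + q1 * ?u l1 y + (p2 * ?v m2 y + q2 * ?v l2 y) = 0" .
    qed
    finally show ?thesis by simp
  qed
  have even_eq: "(-1) * Mu (4*t+2) j + (-\<i>) * Mu (4*t+3) j + ((-1) * Mv (4*t) j + (-\<i>) * Mv (4*t+1) j) = 0"
    if "t < CARD('n)" for t j
    by (rule lin) (use eq[of _ "2*t"] that in \<open>simp add: nabla_def\<close>)
  have odd_eq: "1 * Mu (4*t) j + (-\<i>) * Mu (4*t+1) j + ((-1) * Mv (4*t+2) j + \<i> * Mv (4*t+3) j) = 0"
    if "t < CARD('n)" for t j
    by (rule lin) (use eq[of _ "2*t+1"] that in \<open>simp add: nabla_def\<close>)
  have "Mu (4*t) (4*t) + Mu (4*t+1) (4*t+1) + Mu (4*t+2) (4*t+2) + Mu (4*t+3) (4*t+3) = 0"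
    if t: "t < CARD('n)" for t
  proof -
    \<comment> \<open>The four equations are weighted so that the diagonal moments of
      \<open>u\<close> survive with coefficient 1; all other moments cancel in pairs by symmetry.
      The computation for \<open>v\<close> is analogous.\<close>
    have "Mu (4*t) (4*t) + Mu (4*t+1) (4*t+1) + Mu (4*t+2) (4*t+2) + Mu (4*t+3) (4*t+3)
      = (1 * Mu (4*t) (4*t) + (-\<i>) * Mu (4*t+1) (4*t) + ((-1) * Mv (4*t+2) (4*t) + \<i> * Mv (4*t+3) (4*t)))
      + \<i> * (1 * Mu (4*t) (4*t+1) + (-\<i>) * Mu (4*t+1) (4*t+1) + ((-1) * Mv (4*t+2) (4*t+1) + \<i> * Mv (4*t+3) (4*t+1)))
      - ((-1) * Mu (4*t+2) (4*t+2) + (-\<i>) * Mu (4*t+3) (4*t+2) + ((-1) * Mv (4*t) (4*t+2) + (-\<i>) * Mv (4*t+1) (4*t+2)))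
      + \<i> * ((-1) * Mu (4*t+2) (4*t+3) + (-\<i>) * Mu (4*t+3) (4*t+3) + ((-1) * Mv (4*t) (4*t+3) + (-\<i>) * Mv (4*t+1) (4*t+3)))"
      using sym[of "4*t" "4*t+1"] sym[of "4*t" "4*t+2"] sym[of "4*t" "4*t+3"]
        sym[of "4*t+1" "4*t+2"] sym[of "4*t+1" "4*t+3"] sym[of "4*t+2" "4*t+3"]
      by (simp add: ring_distribs flip: mult.assoc)
    then show ?thesis by (simp only: even_eq[OF t] odd_eq[OF t] mult_zero_right diff_zero add_0)
  qed
  then show "(\<Sum>b\<in>Basis. bump_moment u x s b b) = 0"
    unfolding sum_Basis_hvec by (intro sum.neutral) (simp add: Mu_def)
  have "Mv (4*t) (4*t) + Mv (4*t+1) (4*t+1) + Mv (4*t+2) (4*t+2) + Mv (4*t+3) (4*t+3) = 0"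
    if t: "t < CARD('n)" for t
  proof -
    have "Mv (4*t) (4*t) + Mv (4*t+1) (4*t+1) + Mv (4*t+2) (4*t+2) + Mv (4*t+3) (4*t+3)
      = \<i> * ((-1) * Mu (4*t+2) (4*t+1) + (-\<i>) * Mu (4*t+3) (4*t+1) + ((-1) * Mv (4*t) (4*t+1) + (-\<i>) * Mv (4*t+1) (4*t+1)))
      - ((-1) * Mu (4*t+2) (4*t) + (-\<i>) * Mu (4*t+3) (4*t) + ((-1) * Mv (4*t) (4*t) + (-\<i>) * Mv (4*t+1) (4*t)))
      - (1 * Mu (4*t) (4*t+2) + (-\<i>) * Mu (4*t+1) (4*t+2) + ((-1) * Mv (4*t+2) (4*t+2) + \<i> * Mv (4*t+3) (4*t+2)))
      - \<i> * (1 * Mu (4*t) (4*t+3) + (-\<i>) * Mu (4*t+1) (4*t+3) + ((-1) * Mv (4*t+2) (4*t+3) + \<i> * Mv (4*t+3) (4*t+3)))"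
      using sym[of "4*t" "4*t+1"] sym[of "4*t" "4*t+2"] sym[of "4*t" "4*t+3"]
        sym[of "4*t+1" "4*t+2"] sym[of "4*t+1" "4*t+3"] sym[of "4*t+2" "4*t+3"]
      by (simp add: ring_distribs flip: mult.assoc)
    then show ?thesis by (simp only: even_eq[OF t] odd_eq[OF t] mult_zero_right diff_zero add_0)
  qed
  then show "(\<Sum>b\<in>Basis. bump_moment v x s b b) = 0"
    unfolding sum_Basis_hvec by (intro sum.neutral) (simp add: Mv_def)
qed

lemma c2_on_of_trace:
  fixes u :: "('n::finite) hvec \<Rightarrow> complex"
  assumes "open U" "c1_on U u"
    and "\<And>x s. 0 < s \<Longrightarrow> (\<And>y. y \<in> cube 3 \<Longrightarrow> x + s *\<^sub>R y \<in> U) \<Longrightarrow>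
      (\<Sum>b\<in>Basis. bump_moment u x s b b) = 0"
  shows "c2_on U u"
  unfolding c2_on_def
proof (intro conjI allI impI)
  fix m
  have "c1_on U (\<lambda>x. frd u x (ax m))"
    by (rule c1_on_frd[OF assms(1,2) _ assms(3)]) (simp add: ax_def)
  then show "c1_on U (pd m u)"
    by (rule c1_on_cong[OF assms(1), rotated]) (use assms(2) in \<open>simp add: pd_eq_frd c1_on_def\<close>)
qed fact

text \<open>For \<open>k = 0\<close> this is part of the definition. For \<open>k \<ge> 1\<close> a
  component and its partner with the first index exchanged form a pair to which the vanishing of the
  trace applies.\<close>

lemma regular_c2_on:
  assumes "open U" and h: "h \<in> regular k U" and len: "length As = k"
  shows "c2_on (U :: ('n::finite) hvec set) (\<lambda>x. h x As)"
proof (cases As)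
  case Nil
  then show ?thesis using h len by (auto simp flip: C_on_2_iff)
next
  case (Cons a Bs)
  then obtain l where k: "k = Suc l" "length Bs = l" using len by auto
  let ?u = "\<lambda>x. h x (P0 # Bs)" and ?v = "\<lambda>x. h x (P1 # Bs)"
  have u: "c1_on U ?u" and v: "c1_on U ?v"
    and eq: "\<And>x B. x \<in> U \<Longrightarrow> B < 2 * CARD('n) \<Longrightarrow> nabla B P0 ?u x + nabla B P1 ?v x = 0"
    using h k by (auto simp: regular_Suc_iff simp del: regular.simps)
  have "c2_on U ?u"
    by (rule c2_on_of_trace[OF assms(1) u sum_bump_moment_eq_0(1)[OF u v eq]])
  moreover have "c2_on U ?v"
    by (rule c2_on_of_trace[OF assms(1) v sum_bump_moment_eq_0(2)[OF u v eq]])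
  ultimately show ?thesis using Cons by (cases a) auto
qed

subsection \<open>Raising the degree by differentiation\<close>

text \<open>Both kinds of index are flipped relative to the coordinates \<open>zc\<close>:
  differentiation with respect to \<open>zc 0 a\<close> is \<open>- 1 / 2\<close> times
  \<open>raise 1\<close> and differentiation with respect to \<open>zc 1 a\<close> is
  \<open>1 / 2\<close> times \<open>raise 0\<close>, with \<open>a\<close> as the new first
  index.\<close>

definition raise :: "nat \<Rightarrow> (('n::finite) hvec \<Rightarrow> pidx list \<Rightarrow> complex) \<Rightarrow> 'n hvec \<Rightarrow> pidx list \<Rightarrow> complex" where
  "raise C h x As = (case As of [] \<Rightarrow> 0
     | P0 # Bs \<Rightarrow> nabla C P1 (\<lambda>y. h y Bs) x
     | P1 # Bs \<Rightarrow> - nabla C P0 (\<lambda>y. h y Bs) x)"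

lemma raise_Cons [simp]:
  "raise C h x (P0 # Bs) = nabla C P1 (\<lambda>y. h y Bs) x"
  "raise C h x (P1 # Bs) = - nabla C P0 (\<lambda>y. h y Bs) x"
  by (simp_all add: raise_def)

lemma regular_sympow: "h \<in> regular k U \<Longrightarrow> x \<in> U \<Longrightarrow> h x \<in> sympow k"
  by (cases k) auto

text \<open>Permutations of the tail together with the exchange of the first two entries generate
  all permutations of a list.\<close>

lemma sympow_SucI:
  assumes "\<And>As. length As \<noteq> Suc k \<Longrightarrow> v As = 0"
    and "\<And>a As Bs. length As = k \<Longrightarrow> mset As = mset Bs \<Longrightarrow> v (a # As) = v (a # Bs)"
    and "\<And>Cs. Suc (length Cs) = k \<Longrightarrow> v (P0 # P1 # Cs) = v (P1 # P0 # Cs)"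
  shows "v \<in> sympow (Suc k)"
proof -
  have "v As = v Bs" if len: "length As = Suc k" and m: "mset As = mset Bs" for As Bs
  proof -
    obtain a As' where A: "As = a # As'" "length As' = k" using len by (cases As) auto
    have "length Bs = Suc k" using len mset_eq_length[OF m] by simp
    then obtain b Bs' where B: "Bs = b # Bs'" "length Bs' = k" by (cases Bs) auto
    show ?thesis
    proof (cases "a = b")
      case True
      then show ?thesis using assms(2)[OF A(2), of Bs' a] A B m by simp
    next
      case False
      from m A B have *: "add_mset a (mset As') = add_mset b (mset Bs')" by simp
      with False obtain K where K: "mset As' = add_mset b K" "mset Bs' = add_mset a K"
        by (auto simp: add_eq_conv_ex)
      \<comment> \<open>\<open>Cs\<close> lists what remains of either tail once the head of the
        other list is removed. Permuting tails leads to \<open>a # b # Cs\<close> and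
        \<open>b # a # Cs\<close>, which differ by the exchange.\<close>
      obtain Cs where Cs: "mset Cs = K" using ex_mset by blast
      then have As': "mset As' = mset (b # Cs)" and Bs': "mset Bs' = mset (a # Cs)" using K by auto
      then have "Suc (length Cs) = k" using A(2) mset_eq_length[OF As'] by simp
      then have "v (a # b # Cs) = v (b # a # Cs)"
        using assms(3) False by (cases a; cases b) auto
      then show ?thesis
        using assms(2)[OF A(2) As', of a] assms(2)[OF B(2) Bs', of b] A B by simp
    qed
  qed
  with assms(1) show ?thesis by (auto simp: sympow_def)
qed

text \<open>Symmetry in the old indices is inherited from \<open>h\<close>, and exchanging the new
  index with an old one is exactly a regularity equation of \<open>h\<close>. The equations for
  \<open>raise C h\<close> are second order identities for \<open>h\<close>, so they use its C2
  regularity.\<close>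

lemma raise_regular:
  fixes U :: "('n::finite) hvec set"
  assumes "open U" and h: "h \<in> regular k U" and C: "C < 2 * CARD('n)"
  shows "raise C h \<in> regular (Suc k) U"
  unfolding regular_Suc_iff
proof (intro conjI ballI allI impI)
  fix x assume x: "x \<in> U"
  show "raise C h x \<in> sympow (Suc k)"
  proof (rule sympow_SucI)
    fix As :: "pidx list" assume len: "length As \<noteq> Suc k"
    show "raise C h x As = 0"
    proof (cases As)
      case (Cons a Bs)
      then have "h y Bs = 0" if "y \<in> U" for y
        using regular_sympow[OF h that] len by (auto simp: sympow_def)
      then have "nabla C b (\<lambda>y. h y Bs) x = 0" for b
        using nabla_cong_open[OF \<open>open U\<close> x, of "\<lambda>y. h y Bs" "\<lambda>y. 0"] by (simp add: nabla_0)
      then show ?thesis using Cons by (cases a) auto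
    qed (simp add: raise_def)
  next
    fix a and As Bs :: "pidx list" assume "length As = k" "mset As = mset Bs"
    then have "h y As = h y Bs" if "y \<in> U" for y
      using regular_sympow[OF h that] by (auto simp: sympow_def)
    then have "nabla C b (\<lambda>y. h y As) x = nabla C b (\<lambda>y. h y Bs) x" for b
      by (rule nabla_cong_open[OF \<open>open U\<close> x])
    then show "raise C h x (a # As) = raise C h x (a # Bs)" by (cases a) auto
  next
    fix Cs :: "pidx list" assume k: "Suc (length Cs) = k"
    then have "nabla C P0 (\<lambda>y. h y (P0 # Cs)) x + nabla C P1 (\<lambda>y. h y (P1 # Cs)) x = 0"
      using h x C unfolding k[symmetric] regular_Suc_iff by blast
    then show "raise C h x (P0 # P1 # Cs) = raise C h x (P1 # P0 # Cs)"
      by (simp add: eq_neg_iff_add_eq_0 add.commute)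
  qed
next
  fix As :: "pidx list" assume "length As = Suc k"
  then obtain a Bs where A: "As = a # Bs" "length Bs = k" by (cases As) auto
  have n: "c1_on U (nabla C b (\<lambda>y. h y Bs))" for b
    by (rule c1_on_nabla[OF regular_c2_on[OF \<open>open U\<close> h A(2)] C])
  show "c1_on U (\<lambda>x. raise C h x As)"
    using n[of P1] c1_on_cmult[OF n[of P0], of "-1"] A by (cases a) auto
next
  fix As :: "pidx list" and x B assume len: "length As = k" and x: "x \<in> U" and B: "B < 2 * CARD('n)"
  let ?\<phi> = "\<lambda>y. h y As"
  have c2: "c2_on U ?\<phi>" by (rule regular_c2_on[OF \<open>open U\<close> h len])
  have d: "nabla D b ?\<phi> differentiable (at x)" if "D < 2 * CARD('n)" for D b
    using c1_on_nabla[OF c2 that] x by (auto simp: c1_on_def)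
  have comm: "nabla D b (nabla E c \<psi>) x = nabla E c (nabla D b \<psi>) x"
    if "c2_on U \<psi>" "D < 2 * CARD('n)" "E < 2 * CARD('n)" for D E b c \<psi>
    by (rule nabla_commute[OF \<open>open U\<close> that(1) x that(2,3)])
  have key: "nabla B P0 (nabla C P1 ?\<phi>) x = nabla B P1 (nabla C P0 ?\<phi>) x"
  proof (cases k)
    case 0
    then have As: "As = []" and h0: "h \<in> regular 0 U" using len h by auto
    \<comment> \<open>The two-form has coefficients for distinct indices only; for
      \<open>B = C\<close> the identity is plain commutation of derivatives.\<close>
    consider "B < C" | "C < B" | "B = C" by linarith
    then show ?thesis
    proof cases
      case 1
      then show ?thesis
        using regular_0_nabla[OF h0 x 1 C] comm[OF c2 C B, of P0 P1] As by simp
    next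
      case 2
      then show ?thesis
        using regular_0_nabla[OF h0 x 2 B] comm[OF c2 B C, of P0 P1] comm[OF c2 B C, of P1 P0] As by simp
    next
      case 3
      then show ?thesis using comm[OF c2 B C] by simp
    qed
  next
    case (Suc l)
    obtain a Bs where A: "As = a # Bs" "length Bs = l" using len Suc by (cases As) auto
    let ?u = "\<lambda>y. h y (P0 # Bs)" and ?v = "\<lambda>y. h y (P1 # Bs)"
    have c: "c2_on U ?u" "c2_on U ?v"
      by (rule regular_c2_on[OF \<open>open U\<close> h]; use A Suc in simp)+
    have eq: "nabla D P0 ?u y = (-1) * nabla D P1 ?v y" if "y \<in> U" "D < 2 * CARD('n)" for y D
      using h that A(2) unfolding Suc regular_Suc_iff by (simp add: eq_neg_iff_add_eq_0)
    have eq': "nabla E b (nabla D P0 ?u) x = - nabla E b (nabla D P1 ?v) x"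
      if "D < 2 * CARD('n)" for D E b
    proof -
      have "nabla E b (nabla D P0 ?u) x = nabla E b (\<lambda>y. (-1) * nabla D P1 ?v y) x"
        by (rule nabla_cong_open[OF \<open>open U\<close> x]) (rule eq[OF _ that])
      also have "\<dots> = (-1) * nabla E b (nabla D P1 ?v) x"
        by (rule nabla_cmult) (use c1_on_nabla[OF c(2) that] x in \<open>auto simp: c1_on_def\<close>)
      finally show ?thesis by simp
    qed
    show ?thesis
    proof (cases a)
      case P0
      \<comment> \<open>Commute, pass from \<open>?u\<close> to \<open>?v\<close> by regularity,
        commute again and pass back; the two signs cancel.\<close>
      have "nabla B P0 (nabla C P1 ?u) x = nabla B P1 (nabla C P0 ?u) x"
        using eq'[OF B, of C P1] eq'[OF C, of B P1] comm[OF c(1) B C] comm[OF c(2) C B] by simp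
      then show ?thesis using P0 A by simp
    next
      case P1
      have "nabla B P0 (nabla C P1 ?v) x = nabla B P1 (nabla C P0 ?v) x"
        using eq'[OF B, of C P0] eq'[OF C, of B P0] comm[OF c(1) B C] comm[OF c(2) C B] by simp
      then show ?thesis using P1 A by simp
    qed
  qed
  show "nabla B P0 (\<lambda>y. raise C h y (P0 # As)) x + nabla B P1 (\<lambda>y. raise C h y (P1 # As)) x = 0"
    using key nabla_cmult[OF d[OF C], of B P1 "-1" P0] by simp
qed

subsection \<open>Averaging over the rescalings of the first quaternion\<close>

definition proj0 :: "('n::finite) hvec \<Rightarrow> 'n hvec" where
  "proj0 x = (\<chi> i. if i \<in> of_nat ` {..<4} then x $ i else 0)"

text \<open>This is the map that sends (q_0, q') to (t q_0, q'), in a form that shows it to be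
  linear in \<open>x\<close> and affine in \<open>t\<close> with velocity
  \<open>proj0 x\<close>.\<close>

definition shrink :: "real \<Rightarrow> ('n::finite) hvec \<Rightarrow> 'n hvec" where
  "shrink t x = x + (t - 1) *\<^sub>R proj0 x"

definition avg :: "(('n::finite) hvec \<Rightarrow> complex) \<Rightarrow> 'n hvec \<Rightarrow> complex" where
  "avg w x = integral {0..1} (\<lambda>t. w (shrink t x))"

lemma four_le: "4 \<le> 4 * CARD('n::finite)"
  by (simp add: Suc_leI)

lemma bounded_linear_proj0: "bounded_linear proj0"
  unfolding linear_conv_bounded_linear[symmetric]
  by (rule linearI) (auto simp: proj0_def vec_eq_iff)

lemma shrink_eq: "shrink t x = (id_blinfun + (t - 1) *\<^sub>R Blinfun proj0) x"
  by (simp add: shrink_def blinfun.bilinear_simps bounded_linear_Blinfun_apply[OF bounded_linear_proj0])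

lemma shrink_1 [simp]: "shrink 1 x = x"
  by (simp add: shrink_def)

lemma norm_shrink:
  assumes "t \<in> {0..1}"
  shows "norm (shrink t x) \<le> norm x"
proof (rule norm_le_componentwise_cart)
  fix i
  have "shrink t x $ i = x $ i \<or> shrink t x $ i = t * x $ i"
    by (auto simp: shrink_def proj0_def algebra_simps)
  then show "norm (shrink t x $ i) \<le> norm (x $ i)"
    using assms by (auto simp: abs_mult intro!: mult_left_le_one_le)
qed

lemma shrink_in_ball: "x \<in> ball 0 r \<Longrightarrow> t \<in> {0..1} \<Longrightarrow> shrink t x \<in> ball 0 r"
  using norm_shrink[of t x] by auto

lemma proj0_ax:
  assumes "m < 4 * CARD('n)"
  shows "proj0 (ax m :: ('n::finite) hvec) = (if m < 4 then ax m else 0)"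
proof -
  have "(of_nat m :: 'n bit0 bit0) \<in> of_nat ` {..<4} \<longleftrightarrow> m < 4"
  proof
    assume "(of_nat m :: 'n bit0 bit0) \<in> of_nat ` {..<4}"
    then obtain l where l: "l < 4" "(of_nat m :: 'n bit0 bit0) = of_nat l" by auto
    then have "l < 4 * CARD('n)" using four_le[where 'n = 'n] by linarith
    then show "m < 4" using of_nat_bit0_eq_iff[OF assms, of l] l by simp
  qed auto
  then show ?thesis
    by (auto simp: proj0_def ax_def vec_eq_iff axis_def)
qed

lemma shrink_ax:
  "m < 4 * CARD('n) \<Longrightarrow> shrink t (ax m :: ('n::finite) hvec) = (if m < 4 then t else 1) *\<^sub>R ax m"
  by (simp add: shrink_def proj0_ax scaleR_left_diff_distrib)

lemma proj0_eq_sum: "proj0 x = (\<Sum>m<4. crd m x *\<^sub>R (ax m :: ('n::finite) hvec))"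
proof -
  have "bounded_linear (proj0 :: 'n hvec \<Rightarrow> _)" by (rule bounded_linear_proj0)
  then have "proj0 x = (\<Sum>b\<in>Basis. (x \<bullet> b) *\<^sub>R proj0 b)"
    by (subst euclidean_representation[of x, symmetric])
       (simp only: linear_sum[OF bounded_linear.linear] linear_cmul[OF bounded_linear.linear])
  also have "\<dots> = (\<Sum>m<4 * CARD('n). (x \<bullet> ax m) *\<^sub>R proj0 (ax m))"
    unfolding Basis_hvec sum.reindex[OF inj_on_ax] o_def ..
  also have "\<dots> = (\<Sum>m<4. (x \<bullet> ax m) *\<^sub>R proj0 (ax m))"
    using four_le[where 'n = 'n] by (intro sum.mono_neutral_right) (auto simp: proj0_ax)
  also have "\<dots> = (\<Sum>m<4. crd m x *\<^sub>R ax m)"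
  proof (rule sum.cong[OF refl])
    fix m :: nat assume "m \<in> {..<4}"
    then have m: "m < 4" "m < 4 * CARD('n)" using less_le_trans[OF _ four_le[where 'n = 'n]] by simp_all
    have "x \<bullet> ax m = crd m x" by (simp add: crd_def ax_def inner_axis)
    with m show "(x \<bullet> ax m) *\<^sub>R proj0 (ax m) = crd m x *\<^sub>R (ax m :: 'n hvec)"
      by (simp add: proj0_ax)
  qed
  finally show ?thesis .
qed

lemma quat_shrink_0: "quat 0 (shrink 0 x) = 0"
proof -
  have "crd m (shrink 0 x) = 0" if "m < 4" for m
    using that by (auto simp: crd_def shrink_def proj0_def)
  then show ?thesis
    by (simp add: quat_def vec_eq_iff forall_4 vector_def)
qed

lemma continuous_on_shrink: "continuous_on S (\<lambda>t. shrink t x)"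
  unfolding shrink_def by (intro continuous_intros)

section \<open>Calculus of the averaging operator\<close>

context
  fixes w :: "('n::finite) hvec \<Rightarrow> complex" and r :: real
  assumes w: "c1_on (ball 0 r) w"
begin

lemma c1_on_avg: "c1_on (ball 0 r) (avg w)"
  and frd_avg: "x \<in> ball 0 r \<Longrightarrow> frd (avg w) x v = integral {0..1} (\<lambda>t. frd w (shrink t x) (shrink t v))"
proof -
  let ?S = "\<lambda>t. id_blinfun + (t - 1) *\<^sub>R Blinfun (proj0 :: 'n hvec \<Rightarrow> 'n hvec)"
  have d: "((\<lambda>x. w (shrink t x)) has_derivative blinfun_apply (frd w (shrink t x) o\<^sub>L ?S t)) (at x)"
    if "x \<in> ball 0 r" "t \<in> cbox 0 1" for x t
  proof -
    have "(shrink t has_derivative shrink t) (at x)"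
      unfolding shrink_eq[abs_def] by (intro bounded_linear_imp_has_derivative blinfun.bounded_linear_right)
    from has_derivative_compose[OF this c1_on_has_derivative[OF w shrink_in_ball]] that show ?thesis
      by (simp add: blinfun_compose.rep_eq o_def shrink_eq)
  qed
  have cont: "continuous_on (ball 0 r \<times> cbox 0 1) (\<lambda>p. shrink (snd p) (fst p))"
    unfolding shrink_def
    by (intro continuous_intros bounded_linear.continuous_on[OF bounded_linear_proj0])
  have c: "continuous_on (cbox 0 1) (\<lambda>t. w (shrink t x))" if "x \<in> ball 0 r" for x
    by (rule continuous_on_compose2[OF c1_on_continuous[OF w] continuous_on_shrink])
       (use that in \<open>auto intro!: le_less_trans[OF norm_shrink]\<close>)
  have "continuous_on (ball 0 r \<times> cbox 0 1) (\<lambda>p. frd w (shrink (snd p) (fst p)))"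
    by (rule continuous_on_compose2[OF c1_on_continuous_frd[OF w] cont]) (auto intro!: le_less_trans[OF norm_shrink])
  then have c': "continuous_on (ball 0 r \<times> cbox 0 1) (\<lambda>(x, t). frd w (shrink t x) o\<^sub>L ?S t)"
    unfolding split_beta by (intro continuous_intros)
  have avg: "avg w = (\<lambda>x. integral (cbox 0 1) (\<lambda>t. w (shrink t x)))"
    by (simp add: avg_def fun_eq_iff)
  show "c1_on (ball 0 r) (avg w)"
    unfolding avg by (rule c1_on_integral(1)[OF open_ball convex_ball d c c'])
  show "frd (avg w) x v = integral {0..1} (\<lambda>t. frd w (shrink t x) (shrink t v))" if "x \<in> ball 0 r"
    using c1_on_integral(2)[OF open_ball convex_ball d c c' that] unfolding avg by (simp add: shrink_eq)
qed

lemma integrable_pd_shrink: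
  assumes "x \<in> ball 0 r"
  shows "(\<lambda>t. pd m w (shrink t x)) integrable_on {0..1}"
proof -
  have "continuous_on {0..1} (\<lambda>t. frd w (shrink t x) (ax m))"
    by (intro continuous_intros continuous_on_compose2[OF c1_on_continuous_frd[OF w] continuous_on_shrink])
       (use assms in \<open>auto intro!: le_less_trans[OF norm_shrink]\<close>)
  then have "(\<lambda>t. frd w (shrink t x) (ax m)) integrable_on {0..1}"
    by (rule integrable_continuous_interval)
  then show ?thesis
    by (rule integrable_eq) (use w shrink_in_ball[OF assms] in \<open>auto simp: pd_eq_frd c1_on_def\<close>)
qed

lemma pd_avg:
  assumes x: "x \<in> ball 0 r" and m: "m < 4 * CARD('n)"
  shows "pd m (avg w) x = integral {0..1} (\<lambda>t. (if m < 4 then t else 1) *\<^sub>R pd m w (shrink t x))"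
proof -
  have "pd m (avg w) x = integral {0..1} (\<lambda>t. frd w (shrink t x) (shrink t (ax m)))"
    using c1_on_avg x by (simp only: pd_eq_frd c1_on_def frd_avg)
  also have "\<dots> = integral {0..1} (\<lambda>t. (if m < 4 then t else 1) *\<^sub>R pd m w (shrink t x))"
    by (rule integral_cong)
       (use w shrink_in_ball[OF x] m in \<open>simp add: shrink_ax pd_eq_frd c1_on_def blinfun.scaleR_right\<close>)
  finally show ?thesis .
qed

text \<open>Both coordinates in \<open>nabla B\<close> belong to the same quaternion, so the chain
  rule produces one common factor: \<open>t\<close> for the first quaternion, that is for
  \<open>B < 2\<close>, and 1 otherwise.\<close>

lemma integrable_weighted_nabla_shrink:
  assumes x: "x \<in> ball 0 r" and B: "B < 2 * CARD('n)"
  shows "(\<lambda>t. (if B < 2 then t else 1) *\<^sub>R nabla B a w (shrink t x)) integrable_on {0..1}"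
    and "nabla B a (avg w) x = integral {0..1} (\<lambda>t. (if B < 2 then t else 1) *\<^sub>R nabla B a w (shrink t x))"
proof -
  obtain p q m l where *: "m < 4 * CARD('n)" "l < 4 * CARD('n)" "m div 4 = B div 2" "l div 4 = B div 2"
    "\<And>\<phi> x. nabla B a \<phi> (x :: 'n hvec) = p * pd m \<phi> x + q * pd l \<phi> x"
    using nabla_coeffs[OF B] by metis
  have "j < 4 \<longleftrightarrow> j div 4 = 0" "j < 2 \<longleftrightarrow> j div 2 = 0" for j :: nat by (simp_all add: div_eq_0_iff)
  then have iff: "m < 4 \<longleftrightarrow> B < 2" "l < 4 \<longleftrightarrow> B < 2" by (simp_all only: *(3,4))
  have c: "continuous_on {0..1} (\<lambda>t. (if B < 2 then t else 1) *\<^sub>R frd w (shrink t x) (ax j))" for j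
    by (cases "B < 2"; simp;
        intro continuous_intros continuous_on_compose2[OF c1_on_continuous_frd[OF w] continuous_on_shrink];
        use x in \<open>auto intro!: le_less_trans[OF norm_shrink]\<close>)
  have i: "(\<lambda>t. (if B < 2 then t else 1) *\<^sub>R pd j w (shrink t x)) integrable_on {0..1}" for j
    by (rule integrable_eq[OF integrable_continuous_interval[OF c]])
       (use w shrink_in_ball[OF x] in \<open>auto simp: pd_eq_frd c1_on_def\<close>)
  have eq: "(if B < 2 then t else 1) *\<^sub>R nabla B a w (shrink t x)
      = p * ((if B < 2 then t else 1) *\<^sub>R pd m w (shrink t x)) + q * ((if B < 2 then t else 1) *\<^sub>R pd l w (shrink t x))" for t
    by (simp add: * scaleR_right_distrib)
  show "(\<lambda>t. (if B < 2 then t else 1) *\<^sub>R nabla B a w (shrink t x)) integrable_on {0..1}"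
    unfolding eq by (intro integrable_add integrable_on_mult_right i)
  show "nabla B a (avg w) x = integral {0..1} (\<lambda>t. (if B < 2 then t else 1) *\<^sub>R nabla B a w (shrink t x))"
    unfolding eq using x *(1,2)
    by (simp only: integral_add integrable_on_mult_right integral_mult_right i *(5) pd_avg iff)
qed

text \<open>Fundamental theorem of calculus along the path from \<open>shrink 0 x\<close> to
  \<open>x\<close>. Its velocity is \<open>proj0 x\<close>, whose coordinates do not depend on
  \<open>t\<close> and come out of the integral.\<close>

lemma sum_crd_integral_pd:
  assumes x: "x \<in> ball 0 r"
  shows "(\<Sum>m<4. crd m x *\<^sub>R avg (pd m w) x) = w x - w (shrink 0 x)"
proof -
  have "((\<lambda>t. w (shrink t x)) has_vector_derivative frd w (shrink t x) (proj0 x)) (at t within {0..1})"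
    if t: "t \<in> {0..1}" for t
  proof -
    have "((\<lambda>t. w (shrink t x)) has_derivative (\<lambda>h. frd w (shrink t x) (h *\<^sub>R proj0 x))) (at t within {0..1})"
      by (rule has_derivative_compose[of "\<lambda>t. shrink t x" _ _ _ w, OF _ c1_on_has_derivative[OF w shrink_in_ball[OF x t]]])
         (auto simp: shrink_def intro!: derivative_eq_intros)
    then show ?thesis by (simp add: has_vector_derivative_def blinfun.scaleR_right)
  qed
  then have "((\<lambda>t. frd w (shrink t x) (proj0 x)) has_integral w (shrink 1 x) - w (shrink 0 x)) {0..1}"
    by (intro fundamental_theorem_of_calculus) auto
  then have "w x - w (shrink 0 x) = integral {0..1} (\<lambda>t. frd w (shrink t x) (proj0 x))"
    by (simp add: integral_unique)
  also have "\<dots> = integral {0..1} (\<lambda>t. \<Sum>m<4. crd m x *\<^sub>R pd m w (shrink t x))"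
    by (rule integral_cong)
       (use w shrink_in_ball[OF x] in \<open>simp add: proj0_eq_sum blinfun.sum_right blinfun.scaleR_right pd_eq_frd c1_on_def\<close>)
  also have "\<dots> = (\<Sum>m<4. crd m x *\<^sub>R avg (pd m w) x)"
    unfolding avg_def by (subst integral_sum) (auto intro!: integrable_cmul integrable_pd_shrink[OF x])
  finally show ?thesis ..
qed

end

text \<open>The two terms of a regularity equation acquire the same factor under rescaling, so the
  averaged equation is the integral of this factor times the original equation at
  \<open>shrink t x\<close>.\<close>

lemma avg_regular:
  fixes F :: "('n::finite) hvec \<Rightarrow> pidx list \<Rightarrow> complex"
  assumes F: "F \<in> regular (Suc k) (ball 0 r)"
  shows "(\<lambda>x As. avg (\<lambda>y. F y As) x) \<in> regular (Suc k) (ball 0 r)"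
  unfolding regular_Suc_iff
proof (intro conjI ballI allI impI)
  fix x :: "'n hvec" assume x: "x \<in> ball 0 r"
  have s: "F (shrink t x) \<in> sympow (Suc k)" if "t \<in> {0..1}" for t
    using F shrink_in_ball[OF x that] by (simp add: regular_sympow del: regular.simps)
  show "(\<lambda>As. avg (\<lambda>y. F y As) x) \<in> sympow (Suc k)"
    unfolding sympow_def avg_def
  proof (intro CollectI conjI allI impI)
    fix As Bs :: "pidx list" assume "length As = Suc k \<and> mset As = mset Bs"
    then show "integral {0..1} (\<lambda>t. F (shrink t x) As) = integral {0..1} (\<lambda>t. F (shrink t x) Bs)"
      using s by (intro integral_cong) (auto simp: sympow_def)
  next
    fix As :: "pidx list" assume "length As \<noteq> Suc k"
    then have "integral {0..1} (\<lambda>t. F (shrink t x) As) = integral {0..1} (\<lambda>t::real. 0)"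
      using s by (intro integral_cong) (auto simp: sympow_def)
    then show "integral {0..1} (\<lambda>t. F (shrink t x) As) = 0" by simp
  qed
next
  fix As :: "pidx list" assume "length As = Suc k"
  then show "c1_on (ball 0 r) (\<lambda>x. avg (\<lambda>y. F y As) x)"
    using F by (intro c1_on_avg) (simp add: regular_Suc_iff del: regular.simps)
next
  fix As :: "pidx list" and x :: "'n hvec" and B
  assume len: "length As = k" and x: "x \<in> ball 0 r" and B: "B < 2 * CARD('n)"
  let ?s = "\<lambda>t. (if B < 2 then t else 1 :: real)"
  have c: "c1_on (ball 0 r) (\<lambda>y. F y (a # As))" for a
    using F len by (simp add: regular_Suc_iff del: regular.simps)
  note i = integrable_weighted_nabla_shrink[OF c x B]
  have "nabla B P0 (avg (\<lambda>y. F y (P0 # As))) x + nabla B P1 (avg (\<lambda>y. F y (P1 # As))) x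
    = integral {0..1} (\<lambda>t. ?s t *\<^sub>R nabla B P0 (\<lambda>y. F y (P0 # As)) (shrink t x)
        + ?s t *\<^sub>R nabla B P1 (\<lambda>y. F y (P1 # As)) (shrink t x))"
    unfolding i(2) by (rule integral_add[OF i(1) i(1), symmetric])
  also have "\<dots> = integral {0..1} (\<lambda>t::real. 0)"
  proof (rule integral_cong)
    fix t :: real assume "t \<in> {0..1}"
    then have "nabla B P0 (\<lambda>y. F y (P0 # As)) (shrink t x) + nabla B P1 (\<lambda>y. F y (P1 # As)) (shrink t x) = 0"
      using F len B shrink_in_ball[OF x] unfolding regular_Suc_iff by blast
    then show "?s t *\<^sub>R nabla B P0 (\<lambda>y. F y (P0 # As)) (shrink t x)
        + ?s t *\<^sub>R nabla B P1 (\<lambda>y. F y (P1 # As)) (shrink t x) = 0"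
      by (simp flip: scaleR_right_distrib)
  qed
  finally show "nabla B P0 (\<lambda>x. avg (\<lambda>y. F y (P0 # As)) x) x + nabla B P1 (\<lambda>x. avg (\<lambda>y. F y (P1 # As)) x) x = 0"
    by simp
qed

section \<open>Assembling the solution\<close>

lemma regular_cmult:
  fixes U :: "('n::finite) hvec set"
  assumes F: "F \<in> regular (Suc k) U"
  shows "(\<lambda>x As. c * F x As) \<in> regular (Suc k) U"
  unfolding regular_Suc_iff
proof (intro conjI ballI allI impI)
  fix x assume "x \<in> U"
  then have "F x \<in> sympow (Suc k)" by (rule regular_sympow[OF F])
  then show "(\<lambda>As. c * F x As) \<in> sympow (Suc k)"
    unfolding sympow_def by auto
next
  fix As :: "pidx list" assume "length As = Suc k"
  then show "c1_on U (\<lambda>x. c * F x As)"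
    using F by (intro c1_on_cmult) (simp add: regular_Suc_iff del: regular.simps)
next
  fix As :: "pidx list" and x B
  assume *: "length As = k" "x \<in> U" "B < 2 * CARD('n)"
  then have "(\<lambda>y. F y (a # As)) differentiable (at x)" for a
    using F by (simp add: regular_Suc_iff c1_on_def del: regular.simps)
  then have "nabla B P0 (\<lambda>y. c * F y (P0 # As)) x + nabla B P1 (\<lambda>y. c * F y (P1 # As)) x
      = c * (nabla B P0 (\<lambda>y. F y (P0 # As)) x + nabla B P1 (\<lambda>y. F y (P1 # As)) x)"
    by (simp add: nabla_cmult distrib_left)
  then show "nabla B P0 (\<lambda>y. c * F y (P0 # As)) x + nabla B P1 (\<lambda>y. c * F y (P1 # As)) x = 0"
    using F * unfolding regular_Suc_iff by auto
qed

lemma regular_Suc_mono: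
  "F \<in> regular (Suc k) U \<Longrightarrow> V \<subseteq> U \<Longrightarrow> F \<in> regular (Suc k) V"
  unfolding regular_Suc_iff by (blast intro: c1_on_subset)


lemma nabla_first:
  "nabla 0 P0 \<phi> x = - pd 2 \<phi> x - \<i> * pd 3 \<phi> x"
  "nabla 0 P1 \<phi> x = - pd 0 \<phi> x - \<i> * pd 1 \<phi> x"
  "nabla 1 P0 \<phi> x = pd 0 \<phi> x - \<i> * pd 1 \<phi> x"
  "nabla 1 P1 \<phi> x = - pd 2 \<phi> x + \<i> * pd 3 \<phi> x"
  by (simp_all add: nabla_def flip: numeral_2_eq_2)

text \<open>The left hand side is the Euler operator in the coordinates of the first quaternion.\<close>

lemma Lop_avg_raise:
  fixes h :: "('n::finite) hvec \<Rightarrow> pidx list \<Rightarrow> complex"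
  assumes w: "c1_on (ball 0 r) (\<lambda>y. h y As)" and x: "x \<in> ball 0 r"
  shows "Lop 0 (\<lambda>x As. (- 1 / 2) * avg (\<lambda>y. raise 1 h y As) x) x As
       + Lop 1 (\<lambda>x As. (1 / 2) * avg (\<lambda>y. raise 0 h y As) x) x As = h x As - h (shrink 0 x) As"
proof -
  let ?p = "\<lambda>m. avg (pd m (\<lambda>y. h y As)) x"
  note i = integrable_pd_shrink[OF w x]
  have avgs:
    "avg (\<lambda>y. raise 1 h y (P0 # As)) x = - ?p 2 + \<i> * ?p 3"
    "avg (\<lambda>y. raise 1 h y (P1 # As)) x = - ?p 0 + \<i> * ?p 1"
    "avg (\<lambda>y. raise 0 h y (P0 # As)) x = - ?p 0 - \<i> * ?p 1"
    "avg (\<lambda>y. raise 0 h y (P1 # As)) x = ?p 2 + \<i> * ?p 3"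
    unfolding avg_def raise_Cons nabla_first
    by (simp_all add: integral_add integral_diff integrable_add integrable_diff integrable_neg
        integrable_on_mult_right i)
  have "h x As - h (shrink 0 x) As = (\<Sum>m<4. crd m x *\<^sub>R ?p m)"
    by (rule sum_crd_integral_pd[OF w x, symmetric])
  also have "\<dots> = of_real (crd 0 x) * ?p 0 + of_real (crd 1 x) * ?p 1
      + of_real (crd 2 x) * ?p 2 + of_real (crd 3 x) * ?p 3"
    by (simp add: eval_nat_numeral scaleR_conv_of_real)
  \<comment> \<open>The coordinates of the first quaternion form conjugate pairs up to sign. The
    mixed terms cancel within each pair and the halves add up to the full derivatives.\<close>
  finally show ?thesis
    unfolding Lop_def avgs by (simp add: zc_def field_simps flip: numeral_2_eq_2)
qed

theorem theorem1p2:
  fixes k :: nat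
  shows "\<exists>\<epsilon>0::real. 0 < \<epsilon>0 \<and> \<epsilon>0 < 1 \<and>
    (\<forall>\<epsilon>. 0 < \<epsilon> \<and> \<epsilon> < \<epsilon>0 \<longrightarrow>
      (\<forall>h \<in> regular k (B0 \<epsilon> :: ('n::finite) hvec set).
        (\<forall>x \<in> B0 \<epsilon>. quat 0 x = 0 \<longrightarrow> (\<forall>As. h x As = 0)) \<longrightarrow>
        (\<exists>f \<in> regular (k + 1) (B0 (\<epsilon>\<^sup>2)). \<exists>g \<in> regular (k + 1) (B0 (\<epsilon>\<^sup>2)).
          \<forall>x \<in> B0 (\<epsilon>\<^sup>2). \<forall>As. Lop 0 f x As + Lop 1 g x As = h x As)))"
\<comment> \<open>Any witness below 1 ensures \<open>\<epsilon>\<^sup>2 \<le> \<epsilon>\<close>, so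
  that functions built on the ball of radius \<open>\<epsilon>\<close> restrict to the smaller
  one.\<close>
proof (intro exI[of _ "1 / 2"] conjI allI impI ballI)
  fix \<epsilon> :: real and h :: "'n hvec \<Rightarrow> pidx list \<Rightarrow> complex"
  assume \<epsilon>: "0 < \<epsilon> \<and> \<epsilon> < 1 / 2" and "h \<in> regular k (B0 \<epsilon>)"
    and h0: "\<forall>x \<in> B0 \<epsilon>. quat 0 x = 0 \<longrightarrow> (\<forall>As. h x As = 0)"
  then have h: "h \<in> regular k (ball 0 \<epsilon>)" by (simp add: B0_eq_ball)
  let ?f = "\<lambda>x As. (- 1 / 2) * avg (\<lambda>y. raise 1 h y As) x"
  let ?g = "\<lambda>x As. (1 / 2) * avg (\<lambda>y. raise 0 h y As) x"
  have sub: "(B0 (\<epsilon>\<^sup>2) :: 'n hvec set) \<subseteq> ball 0 \<epsilon>"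
    unfolding B0_eq_ball using \<epsilon> by (intro subset_ball) (simp add: power2_eq_square mult_left_le)
  have idx: "Suc 0 < 2 * CARD('n)" using four_le[where 'n = 'n] by linarith
  have "?f \<in> regular (Suc k) (ball 0 \<epsilon>)" "?g \<in> regular (Suc k) (ball 0 \<epsilon>)"
    by (intro regular_cmult avg_regular raise_regular[OF open_ball h]; simp add: idx)+
  then have f: "?f \<in> regular (Suc k) (B0 (\<epsilon>\<^sup>2))" and g: "?g \<in> regular (Suc k) (B0 (\<epsilon>\<^sup>2))"
    using sub by (blast intro: regular_Suc_mono)+
  have eq: "Lop 0 ?f x As + Lop 1 ?g x As = h x As" if x: "x \<in> B0 (\<epsilon>\<^sup>2)" for x As
  proof (cases "length As = k")
    case True
    have xb: "x \<in> ball 0 \<epsilon>" using x sub by blast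
    have "c1_on (ball 0 \<epsilon>) (\<lambda>y. h y As)"
      using regular_c2_on[OF open_ball h True] by (simp add: c2_on_def)
    \<comment> \<open>The point \<open>shrink 0 x\<close> stays in the ball and has q_0 = 0, so the
      subtracted value of \<open>h\<close> vanishes.\<close>
    from Lop_avg_raise[where h = h and As = As, OF this xb] show ?thesis
      using h0 shrink_in_ball[OF xb, of 0] quat_shrink_0[of x] by (simp add: B0_eq_ball)
  next
    \<comment> \<open>At lists of the wrong length all three terms are zero by the convention in
      \<open>sympow\<close>.\<close>
    case False
    have "Lop 0 ?f x \<in> sympow k" "Lop 1 ?g x \<in> sympow k" "h x \<in> sympow k"
      by (rule Lop_sympow, rule regular_sympow[OF f x])
         (rule Lop_sympow, rule regular_sympow[OF g x], rule regular_sympow[OF h], use x sub in blast)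
    then show ?thesis using False by (simp add: sympow_def)
  qed
  show "\<exists>f \<in> regular (k + 1) (B0 (\<epsilon>\<^sup>2)). \<exists>g \<in> regular (k + 1) (B0 (\<epsilon>\<^sup>2)).
      \<forall>x \<in> B0 (\<epsilon>\<^sup>2). \<forall>As. Lop 0 f x As + Lop 1 g x As = h x As"
    unfolding Suc_eq_plus1[symmetric] using f g eq by blast
qed simp_all

end
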